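(* Let $M=gK_I$ be a non-trivial nearly invariant subspace of $H^2$ with extremal function $g$ and associated inner function $I$, $I(0)=0$. Suppose that every function in $gK_I$ has a finite non-tangential limit at $\zeta\in\mathbb{T}$. Then $\zeta\in\operatorname{ADC}(I)$ or $\zeta\in N^M$.
   Context: $\mathbb{D}$ is the open unit disk, $\mathbb{T}=\partial\mathbb{D}$, and $H^2$ is the Hardy space of $\mathbb{D}$ with its usual norm $\|\cdot\|$. For an inner function $I$, $K_I:=H^2\ominus IH^2$ is the model space. For $\zeta\in\mathbb{T}$ and $\alpha>1$, $\Gamma_\alpha(\zeta):=\{z\in\mathbb{D}:\frac{|z-\zeta|}{1-|z|}<\alpha\}$. A function $f$ on $\mathbb{D}$ has non-tangential limit $L=\angle\lim_{\lambda\to\zeta}f(\lambda)$ at $\zeta$ if, for every $\alpha>1$, $f(\lambda)\to L$ as $\lambda\to\zeta$ within $\Gamma_\alpha(\zeta)$. $\operatorname{ADC}(I)$ is the set of $\zeta\in\mathbb{T}$ at which $I$ has a finite angular derivative in the sense of Carathéodory: $\angle\lim_{\lambda\to\zeta}I(\lambda)=\eta$ exists with $\eta\in\mathbb{T}$, and $\angle\lim_{\lambda\to\zeta}I'(\lambda)$ exists (and is finite). A closed subspace $M\subset H^2$ is nearly invariant if $f\in M$, $f(0)=0$ imply $f/z\in M$; non-trivial means $M\neq\{0\}$. The extremal function $g$ of such an $M$ is the unique solution of the extremal problem $\sup\{\operatorname{Re} g(0): g\in M,\ \|g\|=1\}$. "Nearly invariant subspace $M=gK_I$ with extremal function $g$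 and associated inner function $I$" means that $M$ is nearly invariant, $g$ is its extremal function, $I$ is inner with $I(0)=0$, $M=gK_I=\{gh:h\in K_I\}$, and multiplication by $g$ is an isometry of $K_I$ onto $M$; by theorems of Hitt and Sarason, such a $g$ has the form $g=a/(1-Ib)$ with $a,b$ in the unit ball of $H^\infty$ and $|a|^2+|b|^2=1$ a.e. on $\mathbb{T}$. $N^M:=\{\zeta\in\mathbb{T}:\ \angle\lim_{\lambda\to\zeta}f(\lambda)=0\ \text{ for all } f\in M\}$. *)

theory Defs
  imports "HOL-Complex_Analysis.Complex_Analysis"
begin

abbreviation unit_disc :: "complex set" where
  "unit_disc \<equiv> ball 0 1"

abbreviation unit_circle :: "complex set" where
  "unit_circle \<equiv> sphere 0 1"

abbreviation taylor_coeff :: "(complex \<Rightarrow> complex) \<Rightarrow> nat \<Rightarrow> complex" where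
  "taylor_coeff f n \<equiv> fps_nth (fps_expansion f 0) n"

text \<open>
  The Hardy space: holomorphic functions on the disc with square-summable Taylor coefficients.
  A function on the disc is represented by the total function that is 0 off the disc,
  so that HOL equality of elements is equality of functions on the disc.
\<close>

definition H2 :: "(complex \<Rightarrow> complex) set" where
  "H2 = {f. f holomorphic_on unit_disc \<and> (\<forall>z. z \<notin> unit_disc \<longrightarrow> f z = 0) \<and>
            summable (\<lambda>n. (norm (taylor_coeff f n))\<^sup>2)}"

definition H2_inner :: "(complex \<Rightarrow> complex) \<Rightarrow> (complex \<Rightarrow> complex) \<Rightarrow> complex" where
  "H2_inner f h = (\<Sum>n. taylor_coeff f n * cnj (taylor_coeff h n))"

definition H2_norm :: "(complex \<Rightarrow> complex) \<Rightarrow> real" where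
  "H2_norm f = sqrt (\<Sum>n. (norm (taylor_coeff f n))\<^sup>2)"

definition closed_subspace_H2 :: "(complex \<Rightarrow> complex) set \<Rightarrow> bool" where
  "closed_subspace_H2 M \<longleftrightarrow>
     M \<subseteq> H2 \<and> (\<lambda>z. 0) \<in> M \<and>
     (\<forall>f\<in>M. \<forall>h\<in>M. (\<lambda>z. f z + h z) \<in> M) \<and>
     (\<forall>c. \<forall>f\<in>M. (\<lambda>z. c * f z) \<in> M) \<and>
     (\<forall>F f. (\<forall>n::nat. F n \<in> M) \<and> f \<in> H2 \<and> (\<lambda>n. H2_norm (\<lambda>z. F n z - f z)) \<longlonglongrightarrow> 0
        \<longrightarrow> f \<in> M)"

definition inner_function :: "(complex \<Rightarrow> complex) \<Rightarrow> bool" where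
  "inner_function I \<longleftrightarrow>
     I holomorphic_on unit_disc \<and> (\<forall>z\<in>unit_disc. norm (I z) \<le> 1) \<and>
     (AE t in lebesgue_on {0..2*pi}.
        \<exists>L. norm L = 1 \<and> ((\<lambda>r. I (complex_of_real r * cis t)) \<longlongrightarrow> L) (at_left 1))"

definition model_space :: "(complex \<Rightarrow> complex) \<Rightarrow> (complex \<Rightarrow> complex) set" where
  "model_space I = {f \<in> H2. \<forall>h\<in>H2. H2_inner f (\<lambda>z. I z * h z) = 0}"

definition stolz_region :: "real \<Rightarrow> complex \<Rightarrow> complex set" where
  "stolz_region \<alpha> \<zeta> = {z \<in> unit_disc. norm (z - \<zeta>) / (1 - norm z) < \<alpha>}"

definition has_nt_limit :: "(complex \<Rightarrow> complex) \<Rightarrow> complex \<Rightarrow> complex \<Rightarrow> bool" where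
  "has_nt_limit f \<zeta> L \<longleftrightarrow> (\<forall>\<alpha>>1. (f \<longlongrightarrow> L) (at \<zeta> within stolz_region \<alpha> \<zeta>))"

definition ADC :: "(complex \<Rightarrow> complex) \<Rightarrow> complex set" where
  "ADC I = {\<zeta> \<in> unit_circle.
     (\<exists>\<eta>\<in>unit_circle. has_nt_limit I \<zeta> \<eta>) \<and> (\<exists>d. has_nt_limit (deriv I) \<zeta> d)}"

text \<open>
  The quotient f/z is the (unique) element h of M with f = z h on the disc; this also fixes
  its value at the removable singularity 0.
\<close>

definition nearly_invariant :: "(complex \<Rightarrow> complex) set \<Rightarrow> bool" where
  "nearly_invariant M \<longleftrightarrow>
     closed_subspace_H2 M \<and> (\<forall>f\<in>M. f 0 = 0 \<longrightarrow> (\<exists>h\<in>M. \<forall>z\<in>unit_disc. f z = z * h z))"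

definition extremal_function :: "(complex \<Rightarrow> complex) set \<Rightarrow> (complex \<Rightarrow> complex) \<Rightarrow> bool" where
  "extremal_function M g \<longleftrightarrow>
     (\<forall>f. is_arg_max (\<lambda>f. Re (f 0)) (\<lambda>f. f \<in> M \<and> H2_norm f = 1) f \<longleftrightarrow> f = g)"

definition nearly_invariant_with ::
    "(complex \<Rightarrow> complex) set \<Rightarrow> (complex \<Rightarrow> complex) \<Rightarrow> (complex \<Rightarrow> complex) \<Rightarrow> bool" where
  "nearly_invariant_with M g I \<longleftrightarrow>
     nearly_invariant M \<and> extremal_function M g \<and> inner_function I \<and> I 0 = 0 \<and>
     M = (\<lambda>h z. g z * h z) ` model_space I \<and>
     (\<forall>h\<in>model_space I. H2_norm (\<lambda>z. g z * h z) = H2_norm h)"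

definition nt_zero_set :: "(complex \<Rightarrow> complex) set \<Rightarrow> complex set" where
  "nt_zero_set M = {\<zeta> \<in> unit_circle. \<forall>f\<in>M. has_nt_limit f \<zeta> 0}"

end

theory Submission
  imports Defs
begin

text \<open>
  Write $k_\mu$ for the reproducing kernel of the model space $K_I$ at $\mu$. Evaluation of
  $g h$ at $\mu$, for $h \in K_I$, is pairing $h$ with $\overline{g(\mu)} k_\mu$. Let $\mu$ tend to
  $\zeta$ along the radius. All functions $g h$ have a limit, so by the uniform boundedness principle
  (\<open>weakly_bounded_imp_bounded\<close>) the vectors $\overline{g(\mu)} k_\mu$ are bounded in norm. Since
  $I(0) = 0$, the constant 1 is the kernel at 0 and $g$ itself has a non-tangential limit $L$.

  If $L = 0$, the vectors $\overline{g(\mu)} k_\mu$ tend to zero coefficientwise, because each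
  coefficient of $k_\mu$ is bounded uniformly in $\mu$. A bounded sequence that converges
  coefficientwise converges weakly (\<open>cinner_tendsto_of_coeff_tendsto\<close>), so the limit of every
  function in $g K_I$ is zero.

  If $L \neq 0$, division by $g$ shows that all functions of $K_I$ have non-tangential limits at
  $\zeta$, and the kernels $k_\mu$ are themselves bounded. For a fixed $\nu$ in the disc with
  $I(\nu) \neq 0$, the function $I$ is an affine function of $(1 - \overline{\nu} z) k_\nu$, so it
  has a limit $\eta$ at $\zeta$, and boundedness of
  $\|k_\mu\|^2 = (1 - |I(\mu)|^2) / (1 - |\mu|^2)$ forces $|\eta| = 1$. The weak limit of the
  $k_\mu$ is the boundary kernel $(1 - \overline{\eta} I) / (1 - \overline{\zeta} z)$. It belongs to
  $K_I$ and so has a non-tangential limit at $\zeta$ as well; up to a unimodular constant it is the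
  difference quotient $(I - \eta) / (z - \zeta)$, and Cauchy's estimate passes from the difference
  quotient to $I'$ (\<open>ADC_if_bounded_kernels\<close>). The Julia-Caratheodory theorem is thus
  replaced by the hypothesis applied to one particular function.

  That $k_\mu$ lies in $K_I$ rests on multiplication by an inner function being isometric on $H^2$,
  which follows from Parseval's identity on circles whose radius increases to 1.
\<close>

section \<open>Parseval on the circle and inner functions\<close>

lemma has_integral_cis_multiple:
  fixes k :: int
  shows "((\<lambda>t. cis (of_int k * t)) has_integral (if k = 0 then of_real (2 * pi) else 0)) {0..2*pi}"
proof (cases "k = 0")
  case True
  have "((\<lambda>t::real. 1::complex) has_integral (2*pi - 0) *\<^sub>R 1) {0..2*pi}"
    using has_integral_const_real[of "1::complex" 0 "2*pi"] by simp
  then show ?thesis using True by (simp add: scaleR_conv_of_real)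
next
  case False
  let ?F = "\<lambda>t::real. cis (of_int k * t) / (\<i> * of_int k)"
  have "((\<lambda>t. cis (of_int k * t)) has_integral (?F (2*pi) - ?F 0)) {0..2*pi}"
  proof (rule fundamental_theorem_of_calculus)
    fix t :: real
    show "(?F has_vector_derivative cis (of_int k * t)) (at t within {0..2*pi})"
      using False unfolding cis_conv_exp
      by (auto intro!: derivative_eq_intros has_vector_derivative_real_field simp: field_simps)
  qed simp
  moreover have "cis (of_int k * (2*pi)) = 1"
    by (metis Ints_of_int cis_multiple_2pi mult.commute)
  ultimately show ?thesis using False by simp
qed

text \<open>
  Expanding the square and integrating term by term, only the diagonal terms survive, because the
  characters of the circle are orthogonal.
\<close>

lemma integral_circle_trig_polynomial:
  fixes b :: "nat \<Rightarrow> complex"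
  shows "(LINT t|lebesgue_on {0..2*pi}. (cmod (\<Sum>n<N. b n * cis t ^ n))\<^sup>2)
           = 2 * pi * (\<Sum>n<N. (cmod (b n))\<^sup>2)"
proof -
  let ?p = "\<lambda>t. \<Sum>n<N. b n * cis t ^ n"
  have expand: "complex_of_real ((cmod (?p t))\<^sup>2)
      = (\<Sum>n<N. \<Sum>m<N. b n * cnj (b m) * cis (of_int (int n - int m) * t))" for t
  proof -
    have "b n * cis t ^ n * cnj (b m * cis t ^ m) = b n * cnj (b m) * cis (of_int (int n - int m) * t)" for n m
    proof -
      have "cis t ^ n * cnj (cis t) ^ m = cis (of_int (int n - int m) * t)"
        by (simp add: cis_cnj cis_mult left_diff_distrib Complex.DeMoivre[of t n] Complex.DeMoivre[of "- t" m])
      moreover have "b n * cis t ^ n * cnj (b m * cis t ^ m) = b n * cnj (b m) * (cis t ^ n * cnj (cis t) ^ m)"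
        by simp
      ultimately show ?thesis by (simp only:)
    qed
    then show ?thesis
      unfolding complex_norm_square cnj_sum sum_product by (simp only:)
  qed
  have "((\<lambda>t. \<Sum>n<N. \<Sum>m<N. b n * cnj (b m) * cis (of_int (int n - int m) * t)) has_integral
         (\<Sum>n<N. \<Sum>m<N. b n * cnj (b m) * (if int n - int m = 0 then of_real (2 * pi) else 0))) {0..2*pi}"
    by (intro has_integral_sum has_integral_mult_right has_integral_cis_multiple) auto
  also have "(\<Sum>n<N. \<Sum>m<N. b n * cnj (b m) * (if int n - int m = 0 then of_real (2 * pi) else 0))
      = (\<Sum>n<N. \<Sum>m<N. if m = n then of_real (2 * pi) * (b n * cnj (b m)) else 0)"
    by (intro sum.cong) auto
  also have "\<dots> = complex_of_real (2 * pi * (\<Sum>n<N. (cmod (b n))\<^sup>2))"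
    by (simp add: sum_distrib_left complex_norm_square flip: of_real_power)
  finally have "((\<lambda>t. complex_of_real ((cmod (?p t))\<^sup>2)) has_integral
      complex_of_real (2 * pi * (\<Sum>n<N. (cmod (b n))\<^sup>2))) {0..2*pi}"
    by (simp only: expand)
  then have "((\<lambda>t. (cmod (?p t))\<^sup>2) has_integral 2 * pi * (\<Sum>n<N. (cmod (b n))\<^sup>2)) {0..2*pi}"
    by (drule_tac has_integral_Re) simp
  moreover have "integrable (lebesgue_on {0..2*pi}) (\<lambda>t. (cmod (?p t))\<^sup>2)"
    by (intro continuous_imp_integrable_real continuous_intros)
  ultimately show ?thesis
    by (simp add: lebesgue_integral_eq_integral integral_unique)
qed

lemma integral_circle_dominated_convergence:
  fixes u :: "nat \<Rightarrow> real \<Rightarrow> real"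
  assumes "\<And>n. continuous_on {0..2*pi} (u n)"
    and "v \<in> borel_measurable (lebesgue_on {0..2*pi})"
    and "AE t in lebesgue_on {0..2*pi}. (\<lambda>n. u n t) \<longlonglongrightarrow> v t"
    and "\<And>n t. \<bar>u n t\<bar> \<le> B"
  shows "(\<lambda>n. LINT t|lebesgue_on {0..2*pi}. u n t) \<longlonglongrightarrow> (LINT t|lebesgue_on {0..2*pi}. v t)"
proof (rule integral_dominated_convergence[where w = "\<lambda>_. B"])
  show "u n \<in> borel_measurable (lebesgue_on {0..2*pi})" for n
    using assms(1) by (intro continuous_imp_measurable_on_sets_lebesgue) auto
  show "integrable (lebesgue_on {0..2*pi}) (\<lambda>_. B)"
    by (intro continuous_imp_integrable_real continuous_intros)
qed (use assms in auto)

text \<open>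
  The partial sums are trigonometric polynomials, dominated by the sum of the moduli of the
  coefficients, so dominated convergence passes the identity for polynomials to the limit.
\<close>

lemma parseval_circle:
  fixes b :: "nat \<Rightarrow> complex"
  assumes "summable (\<lambda>n. cmod (b n))"
  shows "summable (\<lambda>n. (cmod (b n))\<^sup>2)"
    and "(LINT t|lebesgue_on {0..2*pi}. (cmod (\<Sum>n. b n * cis t ^ n))\<^sup>2)
           = 2 * pi * (\<Sum>n. (cmod (b n))\<^sup>2)"
proof -
  let ?S = "\<Sum>n. cmod (b n)"
  let ?p = "\<lambda>N t. \<Sum>n<N. b n * cis t ^ n"
  have sm: "summable (\<lambda>n. cmod (b n * cis t ^ n))" for t
    using assms by (simp add: norm_mult norm_power)
  have bound: "cmod (?p N t) \<le> ?S" for N t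
  proof -
    have "cmod (?p N t) \<le> (\<Sum>n<N. cmod (b n))"
      by (rule order_trans[OF norm_sum]) (simp add: norm_mult norm_power)
    also have "\<dots> \<le> ?S" by (rule sum_le_suminf) (use assms in auto)
    finally show ?thesis .
  qed
  have cont: "continuous_on {0..2*pi} (\<lambda>t. (cmod (?p N t))\<^sup>2)" for N
    by (intro continuous_intros)
  have conv: "(\<lambda>N. (cmod (?p N t))\<^sup>2) \<longlonglongrightarrow> (cmod (\<Sum>n. b n * cis t ^ n))\<^sup>2" for t
    using summable_LIMSEQ[OF summable_norm_cancel[OF sm]] by (intro tendsto_intros)
  have "(\<lambda>t. (cmod (\<Sum>n. b n * cis t ^ n))\<^sup>2) \<in> borel_measurable (lebesgue_on {0..2*pi})"
    by (rule borel_measurable_LIMSEQ_real[OF conv])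
       (intro continuous_imp_measurable_on_sets_lebesgue cont, auto)
  moreover have "\<bar>(cmod (?p N t))\<^sup>2\<bar> \<le> ?S\<^sup>2" for N t
    using power_mono[OF bound, of t N 2] by simp
  ultimately have "(\<lambda>N. LINT t|lebesgue_on {0..2*pi}. (cmod (?p N t))\<^sup>2)
      \<longlonglongrightarrow> (LINT t|lebesgue_on {0..2*pi}. (cmod (\<Sum>n. b n * cis t ^ n))\<^sup>2)" (is "_ \<longlonglongrightarrow> ?J")
    using cont conv by (intro integral_circle_dominated_convergence) auto
  then have "(\<lambda>N. 2 * pi * (\<Sum>n<N. (cmod (b n))\<^sup>2) / (2 * pi)) \<longlonglongrightarrow> ?J / (2 * pi)"
    unfolding integral_circle_trig_polynomial by (intro tendsto_divide) auto
  then have "(\<lambda>n. (cmod (b n))\<^sup>2) sums (?J / (2 * pi))"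
    by (simp add: sums_def)
  then show "summable (\<lambda>n. (cmod (b n))\<^sup>2)" "?J = 2 * pi * (\<Sum>n. (cmod (b n))\<^sup>2)"
    by (auto simp: sums_iff field_simps)
qed

text \<open>
  This is where the boundary values of an inner function enter. By Parseval on the circle of
  radius $r < 1$ the weighted square sum of the coefficients of the product is the mean of
  $|I|^2 |p|^2$ over that circle. As $r$ tends to 1, $|I|$ tends to 1 almost everywhere along the
  radii and the integrands stay bounded, so the mean tends to that of $|p|^2$ on the unit circle.
\<close>

lemma inner_function_times_polynomial:
  fixes I :: "complex \<Rightarrow> complex" and a :: "nat \<Rightarrow> complex" and N :: nat
  assumes I: "inner_function I"
  defines "p \<equiv> \<lambda>z. \<Sum>n<N. a n * z ^ n"
  defines "c \<equiv> taylor_coeff (\<lambda>z. I z * p z)"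
  shows "(\<lambda>m. (cmod (c m))\<^sup>2) sums (\<Sum>n<N. (cmod (a n))\<^sup>2)"
proof -
  let ?F = "\<lambda>z. I z * p z"
  let ?A = "\<Sum>n<N. (cmod (a n))\<^sup>2"
  define r :: "nat \<Rightarrow> real" where "r n = 1 - 1 / real (n + 2)" for n
  have r: "0 < r n" "r n < 1" for n by (auto simp: r_def field_simps)
  have r_lim: "r \<longlonglongrightarrow> 1" unfolding r_def by real_asymp
  have holI: "I holomorphic_on unit_disc" and I1: "\<And>z. z \<in> unit_disc \<Longrightarrow> cmod (I z) \<le> 1"
    using I by (auto simp: inner_function_def)
  have holF: "?F holomorphic_on unit_disc"
    unfolding p_def by (intro holomorphic_intros holI)
  have sums_F: "(\<lambda>m. c m * z ^ m) sums ?F z" if "cmod z < 1" for z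
    using holomorphic_power_series[OF holF, of z] that by (simp add: c_def fps_expansion_def)
  have in_disc: "complex_of_real (r n) * cis t \<in> unit_disc" for n t
    using r[of n] by (simp add: norm_mult)
  \<comment> \<open>Convergence at a larger radius gives absolute convergence on the circle of radius
    $r_n$.\<close>
  have abs_sum: "summable (\<lambda>m. cmod (c m * of_real (r n) ^ m))" for n
  proof -
    obtain s where s: "r n < s" "s < 1" using r dense by blast
    have "summable (\<lambda>m. c m * of_real s ^ m)"
      using sums_F[of "of_real s"] s r[of n] by (auto simp: sums_iff)
    then show ?thesis
      using powser_insidea[of c "of_real s" "of_real (r n)"] s r[of n] by simp
  qed
  have F_eq: "(\<Sum>m. c m * of_real (r n) ^ m * cis t ^ m) = ?F (of_real (r n) * cis t)" for n t
    using sums_F[of "of_real (r n) * cis t"] in_disc[of n t]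
    by (simp add: sums_iff power_mult_distrib mult.assoc)
  note parseval = parseval_circle[OF abs_sum, unfolded F_eq]
  have mean_lim: "(\<lambda>n. LINT t|lebesgue_on {0..2*pi}. (cmod (?F (of_real (r n) * cis t)))\<^sup>2)
     \<longlonglongrightarrow> (LINT t|lebesgue_on {0..2*pi}. (cmod (p (cis t)))\<^sup>2)"
  proof (rule integral_circle_dominated_convergence)
    show "continuous_on {0..2*pi} (\<lambda>t. (cmod (?F (of_real (r n) * cis t)))\<^sup>2)" for n
      using in_disc
      by (intro continuous_intros continuous_on_compose2[OF holomorphic_on_imp_continuous_on[OF holF]]) auto
    show "(\<lambda>t. (cmod (p (cis t)))\<^sup>2) \<in> borel_measurable (lebesgue_on {0..2*pi})"
      unfolding p_def by (intro continuous_imp_measurable_on_sets_lebesgue continuous_intros) auto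
    have "(\<lambda>n. (cmod (?F (of_real (r n) * cis t)))\<^sup>2) \<longlonglongrightarrow> (cmod (p (cis t)))\<^sup>2"
      if L: "cmod L = 1" "((\<lambda>r. I (complex_of_real r * cis t)) \<longlongrightarrow> L) (at_left 1)" for t L
    proof -
      have "filterlim r (at_left 1) sequentially"
        unfolding filterlim_at using r r_lim by (auto intro!: always_eventually simp: less_imp_neq)
      then have "(\<lambda>n. I (complex_of_real (r n) * cis t)) \<longlonglongrightarrow> L"
        by (rule filterlim_compose[OF L(2)])
      moreover have "(\<lambda>n. p (complex_of_real (r n) * cis t)) \<longlonglongrightarrow> p (complex_of_real 1 * cis t)"
        unfolding p_def by (intro tendsto_intros r_lim)
      ultimately have "(\<lambda>n. (cmod (?F (of_real (r n) * cis t)))\<^sup>2) \<longlonglongrightarrow> (cmod (L * p (of_real 1 * cis t)))\<^sup>2"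
        by (intro tendsto_intros)
      then show ?thesis using L by (simp add: norm_mult)
    qed
    then show "AE t in lebesgue_on {0..2*pi}.
        (\<lambda>n. (cmod (?F (of_real (r n) * cis t)))\<^sup>2) \<longlonglongrightarrow> (cmod (p (cis t)))\<^sup>2"
      using I unfolding inner_function_def by (blast intro: eventually_mono)
    show "\<bar>(cmod (?F (of_real (r n) * cis t)))\<^sup>2\<bar> \<le> (\<Sum>n<N. cmod (a n))\<^sup>2" for n t
    proof -
      let ?z = "of_real (r n) * cis t"
      have z: "cmod ?z \<le> 1" using in_disc[of n t] by simp
      have "cmod (p ?z) \<le> (\<Sum>n<N. cmod (a n * ?z ^ n))" unfolding p_def by (rule norm_sum)
      also have "\<dots> \<le> (\<Sum>n<N. cmod (a n))"
        using z by (intro sum_mono) (auto simp: norm_mult norm_power intro!: mult_left_le power_le_one)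
      finally have "cmod (p ?z) \<le> (\<Sum>n<N. cmod (a n))" .
      moreover have "cmod (I ?z) \<le> 1" using I1 in_disc by blast
      ultimately have "cmod (?F ?z) \<le> 1 * (\<Sum>n<N. cmod (a n))"
        unfolding norm_mult by (intro mult_mono) auto
      then show ?thesis using power_mono[of "cmod (?F ?z)" _ 2] by simp
    qed
  qed
  define S where "S n = (\<Sum>m. (cmod (c m * of_real (r n) ^ m))\<^sup>2)" for n
  have S_lim: "S \<longlonglongrightarrow> ?A"
  proof -
    have "(\<lambda>n. (2 * pi * S n) / (2 * pi)) \<longlonglongrightarrow> (2 * pi * ?A) / (2 * pi)"
      using mean_lim unfolding parseval(2) S_def unfolding p_def integral_circle_trig_polynomial
      by (intro tendsto_divide) auto
    then show ?thesis by simp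
  qed
  \<comment> \<open>The coefficients of the product are not yet known to be square summable, so finite sums
    are compared with the limit of the weighted sums first.\<close>
  have partial: "(\<Sum>m<K. (cmod (c m))\<^sup>2) \<le> ?A" for K
  proof (rule LIMSEQ_le[OF _ S_lim])
    show "(\<lambda>n. \<Sum>m<K. (cmod (c m * of_real (r n) ^ m))\<^sup>2) \<longlonglongrightarrow> (\<Sum>m<K. (cmod (c m))\<^sup>2)"
      using r_lim by (auto intro!: tendsto_eq_intros)
    show "\<exists>N. \<forall>n\<ge>N. (\<Sum>m<K. (cmod (c m * of_real (r n) ^ m))\<^sup>2) \<le> S n"
      unfolding S_def using parseval(1) by (intro exI allI impI sum_le_suminf) auto
  qed
  have sm: "summable (\<lambda>m. (cmod (c m))\<^sup>2)"
    by (rule bounded_imp_summable[where B = ?A]) (use partial[of "Suc _"] in \<open>auto simp: lessThan_Suc_atMost\<close>)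
  have "(\<Sum>m. (cmod (c m))\<^sup>2) \<le> ?A"
    by (rule suminf_le_const[OF sm]) (use partial in \<open>auto\<close>)
  moreover have "?A \<le> (\<Sum>m. (cmod (c m))\<^sup>2)"
  proof (rule LIMSEQ_le_const2[OF S_lim], intro exI allI impI)
    fix n
    show "S n \<le> (\<Sum>m. (cmod (c m))\<^sup>2)"
      unfolding S_def using r[of n]
      by (intro suminf_le[OF _ parseval(1) sm])
         (auto simp: norm_mult norm_power power_mult_distrib intro!: mult_left_le power_le_one)
  qed
  ultimately show ?thesis using sm by (simp add: sums_iff)
qed

section \<open>The Hardy space as a Hilbert space of power series\<close>

text \<open>
  Elements of the Hardy space are represented by their Taylor series. Since this is a type, the
  classes of real inner product spaces and complete spaces supply norms, Cauchy-Schwarz, closed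
  subspaces and the Baire category theorem; the complex structure is carried by a separate scalar
  multiplication and a complex inner product whose real part is the inner product of the class.
\<close>

typedef hardy = "{F :: complex fps. summable (\<lambda>n. (cmod (fps_nth F n))\<^sup>2)}"
  morphisms series Hardy
  by (rule exI[of _ 0]) simp

setup_lifting type_definition_hardy

abbreviation hcoeff :: "hardy \<Rightarrow> nat \<Rightarrow> complex" where
  "hcoeff x n \<equiv> fps_nth (series x) n"

lemma hardy_eqI: "(\<And>n. hcoeff x n = hcoeff y n) \<Longrightarrow> x = y"
  by (simp add: fps_eq_iff flip: series_inject)

lemma summable_hcoeff_square: "summable (\<lambda>n. (cmod (hcoeff x n))\<^sup>2)"
  using series[of x] by simp

lemma summable_square_add:
  fixes a b :: "nat \<Rightarrow> complex"
  assumes "summable (\<lambda>n. (cmod (a n))\<^sup>2)" "summable (\<lambda>n. (cmod (b n))\<^sup>2)"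
  shows "summable (\<lambda>n. (cmod (a n + b n))\<^sup>2)"
proof (rule summable_comparison_test')
  show "summable (\<lambda>n. 2 * (cmod (a n))\<^sup>2 + 2 * (cmod (b n))\<^sup>2)"
    using assms by (intro summable_add summable_mult)
  fix n
  have "(cmod (a n + b n))\<^sup>2 \<le> (cmod (a n) + cmod (b n))\<^sup>2"
    by (intro power_mono norm_triangle_ineq) auto
  also have "\<dots> \<le> 2 * (cmod (a n))\<^sup>2 + 2 * (cmod (b n))\<^sup>2"
    using sum_squares_bound[of "cmod (a n)" "cmod (b n)"] by (simp add: power2_sum)
  finally show "norm ((cmod (a n + b n))\<^sup>2) \<le> 2 * (cmod (a n))\<^sup>2 + 2 * (cmod (b n))\<^sup>2"
    by simp
qed

lift_definition scaleC :: "complex \<Rightarrow> hardy \<Rightarrow> hardy" is "\<lambda>c F. fps_const c * F"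
  by (simp add: norm_mult power_mult_distrib summable_mult)

lemma hcoeff_scaleC [simp]: "hcoeff (scaleC c x) n = c * hcoeff x n"
  by (simp add: scaleC.rep_eq)

definition cinner :: "hardy \<Rightarrow> hardy \<Rightarrow> complex" where
  "cinner x y = (\<Sum>n. hcoeff x n * cnj (hcoeff y n))"

lemma summable_cinner: "summable (\<lambda>n. hcoeff x n * cnj (hcoeff y n))"
proof (rule summable_comparison_test')
  show "summable (\<lambda>n. (cmod (hcoeff x n))\<^sup>2 + (cmod (hcoeff y n))\<^sup>2)"
    by (intro summable_add summable_hcoeff_square)
  show "norm (hcoeff x n * cnj (hcoeff y n)) \<le> (cmod (hcoeff x n))\<^sup>2 + (cmod (hcoeff y n))\<^sup>2" for n
  proof -
    have "2 * (cmod (hcoeff x n) * cmod (hcoeff y n)) \<le> (cmod (hcoeff x n))\<^sup>2 + (cmod (hcoeff y n))\<^sup>2"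
      using sum_squares_bound[of "cmod (hcoeff x n)" "cmod (hcoeff y n)"] by simp
    moreover have "0 \<le> cmod (hcoeff x n) * cmod (hcoeff y n)" by simp
    ultimately show ?thesis unfolding norm_mult complex_mod_cnj by linarith
  qed
qed

instantiation hardy :: real_inner
begin

lift_definition zero_hardy :: hardy is 0 by simp

lift_definition plus_hardy :: "hardy \<Rightarrow> hardy \<Rightarrow> hardy" is "(+)"
  by (simp add: summable_square_add)

lift_definition uminus_hardy :: "hardy \<Rightarrow> hardy" is uminus
  by simp

definition minus_hardy :: "hardy \<Rightarrow> hardy \<Rightarrow> hardy" where "minus_hardy x y = x + - y"

definition scaleR_hardy :: "real \<Rightarrow> hardy \<Rightarrow> hardy" where
  "scaleR_hardy r = scaleC (of_real r)"

definition inner_hardy :: "hardy \<Rightarrow> hardy \<Rightarrow> real" where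
  "inner_hardy x y = Re (cinner x y)"

definition norm_hardy :: "hardy \<Rightarrow> real" where "norm_hardy x = sqrt (inner x x)"

definition sgn_hardy :: "hardy \<Rightarrow> hardy" where "sgn_hardy x = inverse (norm x) *\<^sub>R x"

definition dist_hardy :: "hardy \<Rightarrow> hardy \<Rightarrow> real" where "dist_hardy x y = norm (x - y)"

definition uniformity_hardy :: "(hardy \<times> hardy) filter" where
  "uniformity_hardy = (INF e\<in>{0<..}. principal {(x, y). dist x y < e})"

definition open_hardy :: "hardy set \<Rightarrow> bool" where
  "open_hardy U \<longleftrightarrow> (\<forall>x\<in>U. eventually (\<lambda>(x', y). x' = x \<longrightarrow> y \<in> U) uniformity)"

instance
proof
  fix x y z :: hardy and a b :: real
  have coeff [simp]: "hcoeff 0 n = 0" "hcoeff (x + y) n = hcoeff x n + hcoeff y n"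
      "hcoeff (- x) n = - hcoeff x n" "hcoeff (a *\<^sub>R x) n = of_real a * hcoeff x n" for x y a n
    by (simp_all add: zero_hardy.rep_eq plus_hardy.rep_eq uminus_hardy.rep_eq scaleR_hardy_def)
  have square: "hcoeff x n * cnj (hcoeff x n) = of_real ((cmod (hcoeff x n))\<^sup>2)" for n
    by (simp only: complex_norm_square)
  have inner_sq: "inner x x = (\<Sum>n. (cmod (hcoeff x n))\<^sup>2)"
    unfolding inner_hardy_def cinner_def square suminf_of_real[OF summable_hcoeff_square, symmetric]
    by simp
  show "x + y + z = x + (y + z)" "x + y = y + x" "0 + x = x" "- x + x = 0" "x - y = x + - y"
    "a *\<^sub>R (x + y) = a *\<^sub>R x + a *\<^sub>R y" "(a + b) *\<^sub>R x = a *\<^sub>R x + b *\<^sub>R x"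
    "a *\<^sub>R b *\<^sub>R x = (a * b) *\<^sub>R x" "1 *\<^sub>R x = x"
    by (auto intro!: hardy_eqI simp: algebra_simps minus_hardy_def)
  show "dist x y = norm (x - y)" by (rule dist_hardy_def)
  show "sgn x = inverse (norm x) *\<^sub>R x" by (rule sgn_hardy_def)
  show "norm x = sqrt (inner x x)" by (rule norm_hardy_def)
  show "uniformity = (INF e\<in>{0<..}. principal {(x :: hardy, y). dist x y < e})"
    by (rule uniformity_hardy_def)
  show "open U \<longleftrightarrow> (\<forall>x\<in>U. eventually (\<lambda>(x', y). x' = x \<longrightarrow> y \<in> U) uniformity)" for U :: "hardy set"
    by (rule open_hardy_def)
  show "inner x y = inner y x"
    unfolding inner_hardy_def cinner_def Re_suminf[OF summable_cinner] by (simp add: mult.commute)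
  show "inner (x + y) z = inner x z + inner y z"
    unfolding inner_hardy_def cinner_def plus_complex.sel(1)[symmetric]
      suminf_add[OF summable_cinner summable_cinner] by (simp add: ring_distribs)
  show "inner (a *\<^sub>R x) y = a * inner x y"
    unfolding inner_hardy_def cinner_def
    using suminf_mult[OF summable_cinner[of x y], of "of_real a"] by (simp add: mult.assoc)
  show "0 \<le> inner x x" unfolding inner_sq by (intro suminf_nonneg summable_hcoeff_square) simp
  have "inner x x = 0 \<longleftrightarrow> (\<forall>n. (cmod (hcoeff x n))\<^sup>2 = 0)"
    unfolding inner_sq by (rule suminf_eq_zero_iff[OF summable_hcoeff_square]) simp
  also have "\<dots> \<longleftrightarrow> (\<forall>n. hcoeff x n = hcoeff 0 n)" by simp
  also have "\<dots> \<longleftrightarrow> x = 0" using hardy_eqI by blast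
  finally show "inner x x = 0 \<longleftrightarrow> x = 0" .
qed

end

lemma hcoeff_simps [simp]:
  "hcoeff 0 n = 0" "hcoeff (x + y) n = hcoeff x n + hcoeff y n"
  "hcoeff (- x) n = - hcoeff x n" "hcoeff (x - y) n = hcoeff x n - hcoeff y n"
  "hcoeff (a *\<^sub>R x) n = of_real a * hcoeff x n"
  unfolding minus_hardy_def
  by (simp_all add: zero_hardy.rep_eq plus_hardy.rep_eq uminus_hardy.rep_eq scaleR_hardy_def
      del: add_uminus_conv_diff)

lemma cinner_self_suminf: "cinner x x = of_real (\<Sum>n. (cmod (hcoeff x n))\<^sup>2)"
proof -
  have "hcoeff x n * cnj (hcoeff x n) = of_real ((cmod (hcoeff x n))\<^sup>2)" for n
    by (simp only: complex_norm_square)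
  then show ?thesis
    unfolding cinner_def by (simp only: suminf_of_real[OF summable_hcoeff_square])
qed

lemma norm_hardy_square_sums: "(\<lambda>n. (cmod (hcoeff x n))\<^sup>2) sums (norm x)\<^sup>2"
proof -
  have "(norm x)\<^sup>2 = (\<Sum>n. (cmod (hcoeff x n))\<^sup>2)"
    using cinner_self_suminf[of x] by (simp add: power2_norm_eq_inner inner_hardy_def)
  then show ?thesis using summable_hcoeff_square by (simp add: sums_iff)
qed

lemma cinner_self: "cinner x x = of_real ((norm x)\<^sup>2)"
  unfolding cinner_self_suminf using norm_hardy_square_sums[of x] by (simp add: sums_iff)

lemma cmod_hcoeff_le_norm: "cmod (hcoeff x n) \<le> norm x"
proof -
  have "(\<Sum>m\<in>{n}. (cmod (hcoeff x m))\<^sup>2) \<le> (norm x)\<^sup>2"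
    using sum_le_suminf[OF summable_hcoeff_square[of x], of "{n}"] norm_hardy_square_sums[of x]
    by (simp add: sums_iff)
  then show ?thesis by (simp add: power2_le_iff_abs_le)
qed

text \<open>
  The complex inner product is determined by the real one, so that additivity in both arguments,
  polarization and the like carry over from the class.
\<close>

lemma cinner_eq_inner: "cinner x y = Complex (inner x y) (inner x (scaleC \<i> y))"
proof -
  have "cinner x (scaleC \<i> y) = - \<i> * cinner x y"
    unfolding cinner_def suminf_mult[OF summable_cinner, symmetric] by (simp add: mult_ac)
  then show ?thesis by (simp add: inner_hardy_def complex_eq_iff)
qed

lemma cinner_diff_left: "cinner (x - y) z = cinner x z - cinner y z"
  by (rule complex_eqI) (simp_all add: cinner_eq_inner inner_diff_left)

lemma scaleC_diff: "scaleC c (x - y) = scaleC c x - scaleC c y"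
  by (rule hardy_eqI) (simp add: right_diff_distrib)

lemma cinner_diff_right: "cinner x (y - z) = cinner x y - cinner x z"
  by (rule complex_eqI) (simp_all add: cinner_eq_inner scaleC_diff inner_diff_right)

lemma cinner_scaleC_left: "cinner (scaleC c x) y = c * cinner x y"
  unfolding cinner_def suminf_mult[OF summable_cinner, symmetric] by (simp add: mult.assoc)

lemma cinner_scaleC_right: "cinner x (scaleC c y) = cnj c * cinner x y"
  unfolding cinner_def suminf_mult[OF summable_cinner, symmetric] by (simp add: mult_ac)

lemma norm_scaleC: "norm (scaleC c x) = cmod c * norm x"
proof -
  have "(\<lambda>n. (cmod (hcoeff (scaleC c x) n))\<^sup>2) sums ((cmod c)\<^sup>2 * (norm x)\<^sup>2)"
    using sums_mult[OF norm_hardy_square_sums[of x], of "(cmod c)\<^sup>2"]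
    by (simp add: norm_mult power_mult_distrib)
  then have "(norm (scaleC c x))\<^sup>2 = (cmod c * norm x)\<^sup>2"
    unfolding power_mult_distrib by (rule sums_unique2[OF norm_hardy_square_sums])
  then show ?thesis by (simp add: power2_eq_iff_nonneg)
qed

text \<open>
  Cauchy-Schwarz for the real inner product, applied after rotating one vector by a unimodular
  constant that makes the complex inner product real and nonnegative.
\<close>

lemma cmod_cinner_le: "cmod (cinner x y) \<le> norm x * norm y"
proof (cases "cinner x y = 0")
  case False
  let ?u = "cinner x y / of_real (cmod (cinner x y))"
  have "cnj (cinner x y) * cinner x y = of_real ((cmod (cinner x y))\<^sup>2)"
    by (subst mult.commute) (rule complex_norm_square[symmetric])
  moreover have "cnj ?u * cinner x y = cnj (cinner x y) * cinner x y / of_real (cmod (cinner x y))"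
    by simp
  ultimately have "cnj ?u * cinner x y = of_real ((cmod (cinner x y))\<^sup>2) / of_real (cmod (cinner x y))"
    by (simp only:)
  also have "\<dots> = of_real (cmod (cinner x y))"
    using False by (simp add: power2_eq_square)
  finally have "cinner x (scaleC ?u y) = of_real (cmod (cinner x y))"
    by (simp only: cinner_scaleC_right)
  then have "cmod (cinner x y) = inner x (scaleC ?u y)"
    by (simp add: inner_hardy_def)
  also have "\<dots> \<le> norm x * norm (scaleC ?u y)" by (rule norm_cauchy_schwarz)
  also have "\<dots> = norm x * norm y" using False by (simp add: norm_scaleC norm_divide)
  finally show ?thesis .
qed simp

lift_definition truncate :: "nat \<Rightarrow> hardy \<Rightarrow> hardy" is "fps_cutoff"
  by (rule summable_finite[of "{..<_}"]) auto

lemma hcoeff_truncate [simp]: "hcoeff (truncate N x) n = (if n < N then hcoeff x n else 0)"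
  by (simp add: truncate.rep_eq)

lemma norm_truncate_square: "(norm (truncate N x))\<^sup>2 = (\<Sum>n<N. (cmod (hcoeff x n))\<^sup>2)"
proof -
  have "(\<lambda>n. (cmod (hcoeff (truncate N x) n))\<^sup>2) sums (\<Sum>n<N. (cmod (hcoeff (truncate N x) n))\<^sup>2)"
    by (rule sums_finite) auto
  then show ?thesis using norm_hardy_square_sums[of "truncate N x"] by (simp add: sums_iff)
qed

lemma norm_truncate_le: "norm (truncate N x) \<le> norm x"
proof (rule power2_le_imp_le)
  show "(norm (truncate N x))\<^sup>2 \<le> (norm x)\<^sup>2"
    unfolding norm_truncate_square using norm_hardy_square_sums[of x]
      sum_le_suminf[OF summable_hcoeff_square[of x], of "{..<N}"]
    by (simp add: sums_iff)
qed simp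

lemma truncate_tendsto: "(\<lambda>N. truncate N x) \<longlonglongrightarrow> x"
proof -
  have "(norm (x - truncate N x))\<^sup>2 = (norm x)\<^sup>2 - (\<Sum>n<N. (cmod (hcoeff x n))\<^sup>2)" for N
  proof -
    have "(\<lambda>n. (cmod (hcoeff x n))\<^sup>2 - (if n < N then (cmod (hcoeff x n))\<^sup>2 else 0)) sums
        ((norm x)\<^sup>2 - (\<Sum>n<N. if n < N then (cmod (hcoeff x n))\<^sup>2 else 0))"
      by (intro sums_diff norm_hardy_square_sums sums_finite) auto
    also have "(\<lambda>n. (cmod (hcoeff x n))\<^sup>2 - (if n < N then (cmod (hcoeff x n))\<^sup>2 else 0)) =
        (\<lambda>n. (cmod (hcoeff (x - truncate N x) n))\<^sup>2)"
      by auto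
    finally show ?thesis using norm_hardy_square_sums[of "x - truncate N x"] by (simp add: sums_iff)
  qed
  moreover have "(\<lambda>N. (norm x)\<^sup>2 - (\<Sum>n<N. (cmod (hcoeff x n))\<^sup>2)) \<longlonglongrightarrow> 0"
    using norm_hardy_square_sums[of x] unfolding sums_def by (auto intro!: tendsto_eq_intros)
  ultimately have "(\<lambda>N. (norm (x - truncate N x))\<^sup>2) \<longlonglongrightarrow> 0" by simp
  then have "(\<lambda>N. norm (x - truncate N x)) \<longlonglongrightarrow> 0"
    using tendsto_real_sqrt by fastforce
  then have "(\<lambda>N. norm (truncate N x - x)) \<longlonglongrightarrow> 0"
    by (simp only: norm_minus_commute)
  then show ?thesis
    by (simp only: tendsto_norm_zero_iff LIM_zero_iff)
qed

section \<open>Weak limits of bounded sequences and completeness\<close>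

text \<open>
  Every finite partial sum of the squares of the limit coefficients is a limit of partial sums
  bounded by the square of the common bound (Fatou for series).
\<close>

lemma hardy_of_coeff_limit:
  assumes bd: "eventually (\<lambda>n. norm (x n) \<le> C) sequentially"
    and lim: "\<And>m. (\<lambda>n. hcoeff (x n) m) \<longlonglongrightarrow> y m"
  obtains z where "\<And>m. hcoeff z m = y m" "norm z \<le> C"
proof -
  have partial: "(\<Sum>m<K. (cmod (y m))\<^sup>2) \<le> C\<^sup>2" for K
  proof (rule tendsto_upperbound)
    show "(\<lambda>n. \<Sum>m<K. (cmod (hcoeff (x n) m))\<^sup>2) \<longlonglongrightarrow> (\<Sum>m<K. (cmod (y m))\<^sup>2)"
      by (intro tendsto_intros lim)
    show "\<forall>\<^sub>F n in sequentially. (\<Sum>m<K. (cmod (hcoeff (x n) m))\<^sup>2) \<le> C\<^sup>2"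
      using bd
    proof eventually_elim
      case (elim n)
      then show ?case
        using power_mono[OF order_trans[OF norm_truncate_le[of K "x n"] elim], of 2]
        by (simp add: norm_truncate_square)
    qed
  qed simp
  have sm: "summable (\<lambda>m. (cmod (y m))\<^sup>2)"
    by (rule bounded_imp_summable[where B = "C\<^sup>2"])
       (use partial[of "Suc _"] in \<open>auto simp: lessThan_Suc_atMost\<close>)
  define z where "z = Hardy (Abs_fps y)"
  have z: "hcoeff z m = y m" for m using sm by (simp add: z_def Hardy_inverse)
  have "norm z \<le> C"
  proof (rule power2_le_imp_le)
    show "(norm z)\<^sup>2 \<le> C\<^sup>2"
      using norm_hardy_square_sums[of z] partial suminf_le_const[OF sm]
      by (simp add: sums_iff z)
    obtain n where "norm (x n) \<le> C" using bd by (auto simp: eventually_sequentially)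
    then show "0 \<le> C" by (rule order_trans[OF norm_ge_zero])
  qed
  with z show thesis by (rule that)
qed

text \<open>
  A bounded sequence that converges coefficientwise converges weakly: pairing with a truncation of
  \<open>h\<close> involves finitely many coefficients, and the bound makes the error of the truncation uniformly
  small.
\<close>

lemma cinner_tendsto_of_coeff_tendsto:
  assumes bd: "eventually (\<lambda>n. norm (x n) \<le> C) sequentially"
    and lim: "\<And>m. (\<lambda>n. hcoeff (x n) m) \<longlonglongrightarrow> hcoeff z m"
  shows "(\<lambda>n. cinner (x n) h) \<longlonglongrightarrow> cinner z h"
proof -
  obtain n where "norm (x n) \<le> C" using bd by (auto simp: eventually_sequentially)
  then have C: "0 \<le> C" by (rule order_trans[OF norm_ge_zero])
  define D where "D = C + norm z + 1"
  have D: "D > 0" using C by (simp add: D_def add_nonneg_pos)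
  have trunc: "cinner y (truncate N h) = (\<Sum>m<N. hcoeff y m * cnj (hcoeff h m))" for y N
    unfolding cinner_def by (subst suminf_finite[of "{..<N}"]) auto
  show ?thesis
  proof (rule tendstoI)
    fix e :: real assume e: "e > 0"
    then have "e / (2 * D) > 0" using D by simp
    then obtain N where N: "dist (truncate N h) h < e / (2 * D)"
      using metric_LIMSEQ_D[OF truncate_tendsto[of h]] by blast
    have "(\<lambda>n. cinner (x n) (truncate N h)) \<longlonglongrightarrow> cinner z (truncate N h)"
      unfolding trunc by (intro tendsto_intros lim)
    then have "\<forall>\<^sub>F n in sequentially. dist (cinner (x n) (truncate N h)) (cinner z (truncate N h)) < e / 2"
      using e by (intro tendstoD) auto
    with bd show "\<forall>\<^sub>F n in sequentially. dist (cinner (x n) h) (cinner z h) < e"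
    proof eventually_elim
      case (elim n)
      have "cinner (x n) h - cinner z h
          = (cinner (x n) (truncate N h) - cinner z (truncate N h)) + cinner (x n - z) (h - truncate N h)"
        by (simp add: cinner_diff_left cinner_diff_right)
      then have "dist (cinner (x n) h) (cinner z h)
          \<le> dist (cinner (x n) (truncate N h)) (cinner z (truncate N h)) + cmod (cinner (x n - z) (h - truncate N h))"
        unfolding dist_norm by (simp add: norm_triangle_ineq)
      moreover have "cmod (cinner (x n - z) (h - truncate N h)) \<le> e / 2"
      proof -
        have "cmod (cinner (x n - z) (h - truncate N h)) \<le> norm (x n - z) * norm (h - truncate N h)"
          by (rule cmod_cinner_le)
        also have "\<dots> \<le> D * (e / (2 * D))"
          using elim(1) N norm_triangle_ineq4[of "x n" z] D
          by (intro mult_mono) (auto simp: D_def dist_norm norm_minus_commute)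
        also have "\<dots> = e / 2" using D by simp
        finally show ?thesis .
      qed
      ultimately show ?case using elim(2) by linarith
    qed
  qed
qed

text \<open>
  A Cauchy sequence converges coefficientwise, to an element of the space because it is bounded;
  the same lemma, applied to the differences with one fixed term, turns this into convergence in
  norm.
\<close>

instance hardy :: complete_space
proof
  fix X :: "nat \<Rightarrow> hardy" assume X: "Cauchy X"
  have "Cauchy (\<lambda>n. hcoeff (X n) m)" for m
  proof (rule CauchyI)
    fix e :: real assume "e > 0"
    then obtain M where M: "\<And>i j. i \<ge> M \<Longrightarrow> j \<ge> M \<Longrightarrow> norm (X i - X j) < e"
      using CauchyD[OF X] by blast
    show "\<exists>M. \<forall>i\<ge>M. \<forall>j\<ge>M. norm (hcoeff (X i) m - hcoeff (X j) m) < e"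
    proof (intro exI allI impI)
      fix i j assume "i \<ge> M" "j \<ge> M"
      then show "norm (hcoeff (X i) m - hcoeff (X j) m) < e"
        using cmod_hcoeff_le_norm[of "X i - X j" m] M[of i j] by simp
    qed
  qed
  then have "\<exists>L. (\<lambda>n. hcoeff (X n) m) \<longlonglongrightarrow> L" for m
    by (simp add: Cauchy_convergent_iff convergent_def)
  then obtain y where y: "\<And>m. (\<lambda>n. hcoeff (X n) m) \<longlonglongrightarrow> y m" by metis
  obtain C where C: "\<And>n. norm (X n) \<le> C"
    using cauchy_imp_bounded[OF X] by (auto simp: bounded_iff)
  obtain z where z: "\<And>m. hcoeff z m = y m"
    using hardy_of_coeff_limit[OF always_eventually[OF allI[OF C]] y] by blast
  have "X \<longlonglongrightarrow> z"
  proof (rule LIMSEQ_I)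
    fix e :: real assume e: "e > 0"
    then obtain M where M: "\<And>i j. i \<ge> M \<Longrightarrow> j \<ge> M \<Longrightarrow> norm (X i - X j) < e / 2"
      using CauchyD[OF X, of "e / 2"] by auto
    have "norm (X i - z) < e" if i: "i \<ge> M" for i
    proof -
      have "\<forall>\<^sub>F j in sequentially. norm (X i - X j) \<le> e / 2"
        using M[OF i] by (auto simp: eventually_sequentially intro: less_imp_le)
      moreover have "(\<lambda>j. hcoeff (X i - X j) m) \<longlonglongrightarrow> hcoeff (X i - z) m" for m
        using y by (auto simp: z intro!: tendsto_intros)
      ultimately obtain w where "\<And>m. hcoeff w m = hcoeff (X i - z) m" "norm w \<le> e / 2"
        by (rule hardy_of_coeff_limit) blast
      then have "norm (X i - z) \<le> e / 2" using hardy_eqI by metis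
      with e show ?thesis by linarith
    qed
    then show "\<exists>no. \<forall>n\<ge>no. norm (X n - z) < e" by blast
  qed
  then show "convergent X" by (auto simp: convergent_def)
qed

section \<open>Uniform boundedness\<close>

text \<open>
  The uniform boundedness principle for the functionals represented by a sequence in a closed
  subspace. By Baire, one of the closed sets on which all functionals are bounded by $N$ contains a
  ball of the subspace; testing on the ball in the direction of each \<open>w n\<close> bounds its norm.
\<close>

lemma weakly_bounded_imp_bounded:
  fixes K :: "'a::{real_inner, complete_space} set" and w :: "nat \<Rightarrow> 'a"
  assumes "closed K" "subspace K" and w: "\<And>n. w n \<in> K"
    and weak: "\<And>x. x \<in> K \<Longrightarrow> bounded (range (\<lambda>n. inner x (w n)))"
  shows "bounded (range w)"
proof -
  define A where "A N = {x \<in> K. \<forall>n. \<bar>inner x (w n)\<bar> \<le> real N}" for N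
  have cover: "\<Union>(range A) = K"
  proof -
    have "\<exists>N. x \<in> A N" if x: "x \<in> K" for x
    proof -
      obtain b where b: "\<And>n. \<bar>inner x (w n)\<bar> \<le> b"
        using weak[OF x] by (auto simp: bounded_iff)
      obtain N where "b \<le> real N" using real_arch_simple by blast
      then show ?thesis using b x by (auto simp: A_def intro: order_trans)
    qed
    then show ?thesis by (auto simp: A_def)
  qed
  have clo: "closedin (top_of_set K) (A N)" for N
  proof -
    have "A N = K \<inter> (\<Inter>n. {x. \<bar>inner x (w n)\<bar> \<le> real N})"
      by (auto simp: A_def)
    moreover have "closed (\<Inter>n. {x. \<bar>inner x (w n)\<bar> \<le> real N})"
      by (intro closed_INT ballI closed_Collect_le continuous_intros)
    ultimately show ?thesis using closedin_closed_Int by metis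
  qed
  obtain N where N: "top_of_set K interior_of A N \<noteq> {}"
  proof (rule ccontr)
    assume "\<not> thesis"
    then have "\<And>N. top_of_set K interior_of A N = {}" using that by blast
    moreover have "completely_metrizable_space (top_of_set K)"
      using \<open>closed K\<close>
      by (intro completely_metrizable_space_closedin completely_metrizable_space_euclidean)
         (simp only: closed_closedin)
    ultimately have "top_of_set K interior_of \<Union>(range A) = {}"
      using clo by (intro Baire_category_alt disjI1 countable_image) auto
    moreover have "top_of_set K interior_of K = K"
      using interior_of_topspace[of "top_of_set K"] by simp
    ultimately have "K = {}" using cover by simp
    then show False using w by blast
  qed
  then obtain x0 U where x0: "x0 \<in> U" "open U" "x0 \<in> K" "K \<inter> U \<subseteq> A N"
    by (auto simp: interior_of_def openin_open)
  obtain e where e: "e > 0" "ball x0 e \<subseteq> U"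
    using x0 open_contains_ball by blast
  have x0A: "x0 \<in> A N" using x0 by blast
  have "norm (w n) \<le> 4 * real N / e" for n
  proof (cases "w n = 0")
    case False
    define u where "u = (e / (2 * norm (w n))) *\<^sub>R w n"
    have "norm u = e / 2" using False e by (simp add: u_def)
    then have "x0 + u \<in> ball x0 e" using e by (simp add: dist_norm)
    moreover have "x0 + u \<in> K"
      unfolding u_def using \<open>subspace K\<close> x0 w by (intro subspace_add subspace_scale) auto
    ultimately have "x0 + u \<in> A N" using e x0 by blast
    then have "\<bar>inner (x0 + u) (w n)\<bar> \<le> real N" "\<bar>inner x0 (w n)\<bar> \<le> real N"
      using x0A by (auto simp: A_def)
    then have "inner u (w n) \<le> 2 * real N" by (simp add: inner_add_left)
    moreover have "inner u (w n) = e / 2 * norm (w n)"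
      using False by (simp add: u_def power2_norm_eq_inner[symmetric] power2_eq_square)
    ultimately show ?thesis using e by (simp add: field_simps)
  qed (use e in simp)
  then show ?thesis by (auto simp: bounded_iff)
qed

section \<open>Series as functions on the disc\<close>

text \<open>
  The value 0 off the disc makes \<open>val\<close> a bijection onto \<open>H2\<close>, whose elements are total functions.
\<close>

definition val :: "hardy \<Rightarrow> complex \<Rightarrow> complex" where
  "val x z = (if z \<in> unit_disc then eval_fps (series x) z else 0)"

lemma fps_conv_radius_series: "fps_conv_radius (series x) \<ge> 1"
  unfolding fps_conv_radius_def
proof (rule conv_radius_geI_ex)
  fix r :: real assume r: "0 < r" "ereal r < 1"
  have "summable (\<lambda>n. hcoeff x n * of_real r ^ n)"
  proof (rule summable_comparison_test')
    show "summable (\<lambda>n. norm x * r ^ n)" using r by (intro summable_mult summable_geometric) auto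
    show "norm (hcoeff x n * of_real r ^ n) \<le> norm x * r ^ n" for n
      using r cmod_hcoeff_le_norm[of x n] by (simp add: norm_mult norm_power mult_right_mono)
  qed
  then show "\<exists>z. norm z = r \<and> summable (\<lambda>n. hcoeff x n * z ^ n)"
    using r by (intro exI[of _ "of_real r"]) auto
qed

lemma less_conv_radius_series: "cmod z < 1 \<Longrightarrow> ereal (cmod z) < fps_conv_radius (series x)"
  using less_le_trans[OF _ fps_conv_radius_series[of x], of "ereal (cmod z)"] by simp

lemma val_has_fps_expansion: "val x has_fps_expansion series x"
proof -
  have "eval_fps (series x) has_fps_expansion series x"
    using less_le_trans[OF _ fps_conv_radius_series[of x], of 0] by (intro eval_fps_has_fps_expansion) simp
  moreover have "\<forall>\<^sub>F z in nhds 0. val x z = eval_fps (series x) z"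
    by (rule eventually_mono[OF eventually_nhds_in_open[of unit_disc 0]]) (auto simp: val_def)
  ultimately show ?thesis by (subst has_fps_expansion_cong[OF _ refl]) auto
qed

lemma taylor_coeff_val: "taylor_coeff (val x) n = hcoeff x n"
  by (simp add: fps_expansion_eqI[OF val_has_fps_expansion])

lemma val_holomorphic: "val x holomorphic_on unit_disc"
proof -
  have "eval_fps (series x) holomorphic_on unit_disc"
    by (rule holomorphic_on_eval_fps) (auto intro: less_conv_radius_series)
  then show ?thesis by (rule holomorphic_transform) (simp add: val_def)
qed

lemma H2_eq_range_val: "H2 = range val"
proof
  show "range val \<subseteq> H2"
    using val_holomorphic summable_hcoeff_square by (auto simp: H2_def taylor_coeff_val val_def)
  show "H2 \<subseteq> range val"
  proof
    fix f assume f: "f \<in> H2"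
    then have hol: "f holomorphic_on eball 0 1" by (simp add: H2_def eball_ereal one_ereal_def)
    have "series (Hardy (fps_expansion f 0)) = fps_expansion f 0"
      using f by (intro Hardy_inverse) (simp add: H2_def)
    then have "f z = val (Hardy (fps_expansion f 0)) z" for z
      using f eval_fps_expansion'[OF hol, of z] by (auto simp: val_def H2_def)
    then show "f \<in> range val" by blast
  qed
qed

lemma H2_inner_val: "H2_inner (val x) (val y) = cinner x y"
  by (simp add: H2_inner_def cinner_def taylor_coeff_val)

lemma cinner_commute: "cinner y x = cnj (cinner x y)"
proof -
  have "(\<lambda>n. cnj (hcoeff x n * cnj (hcoeff y n))) sums cnj (cinner x y)"
    unfolding sums_cnj cinner_def by (rule summable_sums[OF summable_cinner])
  then show ?thesis by (simp add: cinner_def sums_iff mult.commute)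
qed

text \<open>
  The Szego kernel, which represents the evaluation at \<open>\<mu>\<close>. For \<open>\<mu>\<close> outside the disc the value is
  arbitrary, because the coefficients are not square summable.
\<close>

definition szego :: "complex \<Rightarrow> hardy" where
  "szego \<mu> = Hardy (Abs_fps (\<lambda>n. cnj \<mu> ^ n))"

lemma hcoeff_szego: "cmod \<mu> < 1 \<Longrightarrow> hcoeff (szego \<mu>) n = cnj \<mu> ^ n"
proof -
  assume "cmod \<mu> < 1"
  then have "summable (\<lambda>n. ((cmod \<mu>)\<^sup>2) ^ n)"
    by (intro summable_geometric) (simp add: abs_square_less_1)
  then show ?thesis
    by (simp add: szego_def Hardy_inverse norm_power mult.commute flip: power_mult)
qed

lemma cinner_szego: "cmod \<mu> < 1 \<Longrightarrow> cinner x (szego \<mu>) = val x \<mu>"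
  by (simp add: cinner_def hcoeff_szego val_def eval_fps_def)

lemma val_szego:
  assumes "cmod \<mu> < 1" "cmod z < 1"
  shows "val (szego \<mu>) z = 1 / (1 - cnj \<mu> * z)"
proof -
  have "cmod (cnj \<mu> * z) < 1 * 1"
    unfolding norm_mult using assms by (intro mult_strict_mono') auto
  then show ?thesis
    using assms by (simp add: val_def eval_fps_def hcoeff_szego suminf_geometric flip: power_mult_distrib)
qed

lemma val_diff: "val (x - y) z = val x z - val y z"
  and val_scaleC: "val (scaleC c x) z = c * val x z"
proof -
  have "cmod z < 1 \<Longrightarrow> val (x - y) z = val x z - val y z"
    by (simp add: cinner_diff_left flip: cinner_szego)
  then show "val (x - y) z = val x z - val y z" by (cases "cmod z < 1") (auto simp: val_def)
  have "cmod z < 1 \<Longrightarrow> val (scaleC c x) z = c * val x z"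
    by (simp add: cinner_scaleC_left flip: cinner_szego)
  then show "val (scaleC c x) z = c * val x z" by (cases "cmod z < 1") (auto simp: val_def)
qed

section \<open>Multiplication by an inner function is isometric\<close>

text \<open>
  For inner \<open>I\<close> the product of the series is again square summable (\<open>series_imul\<close>), so this is the
  multiplication of functions (\<open>val_imul\<close>).
\<close>

definition imul :: "(complex \<Rightarrow> complex) \<Rightarrow> hardy \<Rightarrow> hardy" where
  "imul I x = Hardy (fps_expansion I 0 * series x)"

context
  fixes I :: "complex \<Rightarrow> complex"
  assumes I: "inner_function I"
begin

lemma inner_function_holomorphic: "I holomorphic_on unit_disc"
  and cmod_inner_function_le: "cmod z < 1 \<Longrightarrow> cmod (I z) \<le> 1"
  using I by (auto simp: inner_function_def)

lemma inner_function_has_fps_expansion: "I has_fps_expansion fps_expansion I 0"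
  by (rule has_fps_expansion_fps_expansion[OF _ _ inner_function_holomorphic]) auto

lemma imul_truncate_sums:
  "(\<lambda>m. (cmod (fps_nth (fps_expansion I 0 * series (truncate N x)) m))\<^sup>2) sums (norm (truncate N x))\<^sup>2"
proof -
  let ?p = "\<lambda>z. \<Sum>n<N. hcoeff x n * z ^ n"
  have "val (truncate N x) z = ?p z" if "z \<in> unit_disc" for z
    using that unfolding val_def eval_fps_def by (subst suminf_finite[of "{..<N}"]) auto
  then have "\<forall>\<^sub>F z in nhds 0. ?p z = val (truncate N x) z"
    by (intro eventually_mono[OF eventually_nhds_in_open[of unit_disc 0]]) auto
  then have "?p has_fps_expansion series (truncate N x)"
    using val_has_fps_expansion by (subst has_fps_expansion_cong[OF _ refl])
  then have "fps_expansion (\<lambda>z. I z * ?p z) 0 = fps_expansion I 0 * series (truncate N x)"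
    by (intro fps_expansion_eqI has_fps_expansion_mult inner_function_has_fps_expansion)
  then show ?thesis
    using inner_function_times_polynomial[OF I, of "hcoeff x" N] by (simp add: norm_truncate_square)
qed

text \<open>
  The first $K$ coefficients of a product of series only see the first $K$ coefficients of the
  factors, which reduces the bound to polynomials.
\<close>

lemma imul_partial_sum_le:
  "(\<Sum>m<K. (cmod (fps_nth (fps_expansion I 0 * series x) m))\<^sup>2) \<le> (norm x)\<^sup>2"
proof -
  have "(\<Sum>m<K. (cmod (fps_nth (fps_expansion I 0 * series x) m))\<^sup>2)
      = (\<Sum>m<K. (cmod (fps_nth (fps_expansion I 0 * series (truncate K x)) m))\<^sup>2)"
    by (intro sum.cong refl) (auto simp: fps_mult_nth intro!: arg_cong[of _ _ cmod] sum.cong)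
  also have "\<dots> \<le> (norm (truncate K x))\<^sup>2"
    using imul_truncate_sums[of K x] sum_le_suminf[of _ "{..<K}"] by (fastforce simp: sums_iff)
  also have "\<dots> \<le> (norm x)\<^sup>2" by (intro power_mono norm_truncate_le) simp
  finally show ?thesis .
qed

lemma series_imul: "series (imul I x) = fps_expansion I 0 * series x"
proof -
  have "summable (\<lambda>m. (cmod (fps_nth (fps_expansion I 0 * series x) m))\<^sup>2)"
    by (rule bounded_imp_summable[where B = "(norm x)\<^sup>2"])
       (use imul_partial_sum_le[of x "Suc _"] in \<open>auto simp: lessThan_Suc_atMost\<close>)
  then show ?thesis by (simp add: imul_def Hardy_inverse)
qed

lemma imul_add: "imul I (x + y) = imul I x + imul I y"
  by (simp add: series_imul plus_hardy.rep_eq ring_distribs flip: series_inject)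

lemma imul_scaleC: "imul I (scaleC c x) = scaleC c (imul I x)"
  by (simp add: series_imul scaleC.rep_eq mult_ac flip: series_inject)

lemma norm_imul_le: "norm (imul I x) \<le> norm x"
proof (rule power2_le_imp_le)
  show "(norm (imul I x))\<^sup>2 \<le> (norm x)\<^sup>2"
    using norm_hardy_square_sums[of "imul I x"] imul_partial_sum_le[of x]
      suminf_le_const[OF summable_hcoeff_square[of "imul I x"], of "(norm x)\<^sup>2"]
    by (simp add: sums_iff series_imul)
qed simp

text \<open>
  The identity holds for truncations, and multiplication is continuous because it is a
  contraction.
\<close>

lemma norm_imul: "norm (imul I x) = norm x"
proof -
  have norm_trunc: "norm (imul I (truncate N x)) = norm (truncate N x)" for N
    using imul_truncate_sums[of N x] norm_hardy_square_sums[of "imul I (truncate N x)"]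
    by (simp add: series_imul sums_iff power2_eq_iff_nonneg)
  have le: "norm (imul I (truncate N x) - imul I x) \<le> norm (truncate N x - x)" for N
    using norm_imul_le[of "truncate N x - x"] imul_add[of "truncate N x - x" x] by simp
  have "(\<lambda>N. norm (truncate N x - x)) \<longlonglongrightarrow> 0"
    using truncate_tendsto[of x] by (simp only: tendsto_norm_zero_iff LIM_zero_iff)
  then have "(\<lambda>N. imul I (truncate N x) - imul I x) \<longlonglongrightarrow> 0"
    by (rule Lim_null_comparison[OF always_eventually[OF allI[OF le]]])
  then have "(\<lambda>N. norm (imul I (truncate N x))) \<longlonglongrightarrow> norm (imul I x)"
    by (intro tendsto_norm) (simp only: LIM_zero_iff)
  then show ?thesis
    unfolding norm_trunc using tendsto_norm[OF truncate_tendsto[of x]] LIMSEQ_unique by blast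
qed

text \<open>
  An isometry preserves the real inner product by polarization, and the complex one because it
  commutes with multiplication by \<open>\<i>\<close>.
\<close>

lemma cinner_imul: "cinner (imul I x) (imul I y) = cinner x y"
proof -
  have "inner (imul I x) (imul I y) = inner x y" for x y
    by (simp add: dot_norm norm_imul flip: imul_add)
  then show ?thesis by (simp add: cinner_eq_inner flip: imul_scaleC)
qed

lemma val_imul: "val (imul I x) z = I z * val x z"
proof (cases "cmod z < 1")
  case True
  have hol: "I holomorphic_on eball 0 1"
    using inner_function_holomorphic by (simp add: one_ereal_def)
  have "ereal (cmod z) < 1" using True by simp
  then have "ereal (cmod z) < fps_conv_radius (fps_expansion I 0)"
    using conv_radius_fps_expansion[OF hol] by (rule less_le_trans)
  then show ?thesis
    using True eval_fps_expansion'[OF hol, of z] less_conv_radius_series[OF True, of x]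
    by (simp add: val_def series_imul eval_fps_mult)
qed (simp add: val_def)

end

section \<open>The model space and its kernels\<close>

definition model_series :: "(complex \<Rightarrow> complex) \<Rightarrow> hardy set" where
  "model_series I = {x. \<forall>y. cinner x (imul I y) = 0}"

text \<open>
  The Szego kernel minus its component in $I H^2$, hence the reproducing kernel of the model space.
\<close>

definition model_kernel :: "(complex \<Rightarrow> complex) \<Rightarrow> complex \<Rightarrow> hardy" where
  "model_kernel I \<mu> = szego \<mu> - scaleC (cnj (I \<mu>)) (imul I (szego \<mu>))"

context
  fixes I :: "complex \<Rightarrow> complex"
  assumes I: "inner_function I"
begin

lemma val_mem_model_space_iff: "val x \<in> model_space I \<longleftrightarrow> x \<in> model_series I"
proof -
  have "(\<lambda>z. I z * val y z) = val (imul I y)" for y by (simp add: val_imul[OF I] fun_eq_iff)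
  then show ?thesis by (simp add: model_series_def model_space_def H2_eq_range_val H2_inner_val)
qed

text \<open>
  A complex orthogonal complement is the intersection of the real orthogonal complements, because
  $I H^2$ is stable under multiplication by \<open>\<i>\<close>.
\<close>

lemma model_series_eq_real_orthogonal: "model_series I = (\<Inter>y. {x. inner x (imul I y) = 0})"
proof -
  have "cinner x (imul I y) = 0 \<longleftrightarrow> inner x (imul I y) = 0 \<and> inner x (imul I (scaleC \<i> y)) = 0" for x y
    by (simp add: cinner_eq_inner imul_scaleC[OF I] complex_eq_iff)
  then show ?thesis by (auto simp: model_series_def)
qed

lemma closed_model_series: "closed (model_series I)"
  unfolding model_series_eq_real_orthogonal
  by (intro closed_INT ballI closed_Collect_eq continuous_intros)

lemma subspace_model_series: "subspace (model_series I)"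
  unfolding model_series_eq_real_orthogonal
  by (intro subspace_Inter) (auto simp: subspace_def inner_add_left)

lemma scaleC_mem_model_series: "x \<in> model_series I \<Longrightarrow> scaleC c x \<in> model_series I"
  by (simp add: model_series_def cinner_scaleC_left)

text \<open>
  By the isometry, pairing with \<open>imul I y\<close> gives the same value, $\overline{I(\mu) y(\mu)}$, for both
  terms of the kernel.
\<close>

lemma model_kernel_mem: "cmod \<mu> < 1 \<Longrightarrow> model_kernel I \<mu> \<in> model_series I"
  by (simp add: model_series_def model_kernel_def cinner_diff_left cinner_scaleC_left cinner_imul[OF I]
      cinner_commute[of "szego \<mu>"] cinner_szego val_imul[OF I])

lemma val_model_kernel:
  "cmod \<mu> < 1 \<Longrightarrow> cmod z < 1 \<Longrightarrow> val (model_kernel I \<mu>) z = (1 - cnj (I \<mu>) * I z) / (1 - cnj \<mu> * z)"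
  by (simp add: model_kernel_def val_diff val_scaleC val_imul[OF I] val_szego diff_divide_distrib)

lemma cinner_model_kernel:
  assumes "cmod \<mu> < 1" "x \<in> model_series I"
  shows "cinner x (model_kernel I \<mu>) = val x \<mu>"
  using assms by (simp add: model_series_def model_kernel_def cinner_diff_right cinner_scaleC_right cinner_szego)

lemma norm_model_kernel_square:
  assumes "cmod \<mu> < 1"
  shows "(norm (model_kernel I \<mu>))\<^sup>2 = (1 - (cmod (I \<mu>))\<^sup>2) / (1 - (cmod \<mu>)\<^sup>2)"
proof -
  have "complex_of_real ((norm (model_kernel I \<mu>))\<^sup>2) = val (model_kernel I \<mu>) \<mu>"
    using cinner_model_kernel[OF assms model_kernel_mem[OF assms]] by (simp only: cinner_self)
  also have "\<dots> = (1 - I \<mu> * cnj (I \<mu>)) / (1 - \<mu> * cnj \<mu>)"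
    using assms by (simp add: val_model_kernel mult.commute)
  also have "\<dots> = of_real ((1 - (cmod (I \<mu>))\<^sup>2) / (1 - (cmod \<mu>)\<^sup>2))"
    by (simp only: complex_norm_square[symmetric] of_real_diff of_real_divide of_real_1)
  finally show ?thesis by (simp only: of_real_eq_iff)
qed

lemma hcoeff_model_kernel:
  "cmod \<mu> < 1 \<Longrightarrow> hcoeff (model_kernel I \<mu>) m
     = cnj \<mu> ^ m - cnj (I \<mu>) * (\<Sum>i=0..m. fps_nth (fps_expansion I 0) i * cnj \<mu> ^ (m - i))"
  by (simp add: model_kernel_def series_imul[OF I] fps_mult_nth hcoeff_szego)

text \<open>
  A bound that is uniform in \<open>\<mu>\<close>: a factor that tends to zero therefore makes kernels tend to zero
  coefficientwise, even where the kernels do not converge.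
\<close>

lemma cmod_hcoeff_model_kernel_le:
  assumes \<mu>: "cmod \<mu> < 1"
  shows "cmod (hcoeff (model_kernel I \<mu>) m) \<le> 1 + (\<Sum>i=0..m. cmod (fps_nth (fps_expansion I 0) i))"
proof -
  have pow: "cmod (cnj \<mu> ^ k) \<le> 1" for k
    using \<mu> by (simp add: norm_power power_le_one)
  have "cmod (\<Sum>i=0..m. fps_nth (fps_expansion I 0) i * cnj \<mu> ^ (m - i))
      \<le> (\<Sum>i=0..m. cmod (fps_nth (fps_expansion I 0) i))"
    using pow by (intro sum_norm_le) (simp add: norm_mult mult_left_le)
  then have "cmod (cnj (I \<mu>) * (\<Sum>i=0..m. fps_nth (fps_expansion I 0) i * cnj \<mu> ^ (m - i)))
      \<le> 1 * (\<Sum>i=0..m. cmod (fps_nth (fps_expansion I 0) i))"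
    unfolding norm_mult using cmod_inner_function_le[OF I \<mu>] by (intro mult_mono) auto
  then show ?thesis
    unfolding hcoeff_model_kernel[OF \<mu>] using pow[of m]
    by (intro order_trans[OF norm_triangle_ineq4]) simp
qed

text \<open>
  Multiplication by the zero function is not isometric.
\<close>

lemma inner_function_nonzero: "\<exists>z. cmod z < 1 \<and> I z \<noteq> 0"
proof (rule ccontr)
  assume "\<not> ?thesis"
  then have "val (imul I (szego 0)) z = 0" for z
    unfolding val_imul[OF I] by (auto simp: val_def)
  then have "val (imul I (szego 0)) = (\<lambda>_. 0)" by blast
  then have "series (imul I (szego 0)) = 0"
    using val_has_fps_expansion[of "imul I (szego 0)"] fps_expansion_unique_complex has_fps_expansion_0 by metis
  then have "norm (imul I (szego 0)) = 0"
    by (auto intro!: hardy_eqI)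
  then have "szego 0 = 0" by (simp add: norm_imul[OF I])
  moreover have "hcoeff (szego 0) 0 = 1" by (simp add: hcoeff_szego)
  ultimately show False by simp
qed

end

section \<open>Non-tangential limits\<close>

text \<open>
  The radius is approached along one fixed sequence, so that the uniform boundedness principle and
  weak limits apply to sequences.
\<close>

definition radial_seq :: "complex \<Rightarrow> nat \<Rightarrow> complex" where
  "radial_seq \<zeta> n = of_real (1 - 1 / real (n + 2)) * \<zeta>"

lemma has_nt_limit_transform:
  assumes "has_nt_limit f \<zeta> L" "\<And>z. z \<in> unit_disc \<Longrightarrow> h z = f z"
  shows "has_nt_limit h \<zeta> L"
  unfolding has_nt_limit_def
proof (intro allI impI)
  fix \<alpha> :: real assume "\<alpha> > 1"
  then have "(f \<longlongrightarrow> L) (at \<zeta> within stolz_region \<alpha> \<zeta>)"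
    using assms(1) by (simp add: has_nt_limit_def)
  then show "(h \<longlongrightarrow> L) (at \<zeta> within stolz_region \<alpha> \<zeta>)"
    by (rule Lim_transform_within[OF _ zero_less_one]) (simp add: assms(2) stolz_region_def)
qed

lemma has_nt_limit_divide:
  assumes "has_nt_limit f \<zeta> a" "has_nt_limit h \<zeta> b" "b \<noteq> 0"
  shows "has_nt_limit (\<lambda>z. f z / h z) \<zeta> (a / b)"
  using assms unfolding has_nt_limit_def by (auto intro!: tendsto_divide)

context
  fixes \<zeta> :: complex
  assumes \<zeta>: "\<zeta> \<in> unit_circle"
begin

lemma cmod_radial_seq: "cmod (radial_seq \<zeta> n) = 1 - 1 / real (n + 2)"
proof -
  have "0 \<le> 1 - 1 / real (n + 2)" by (simp add: field_simps)
  then show ?thesis using \<zeta> unfolding radial_seq_def norm_mult norm_of_real by simp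
qed

lemma radial_seq_mem: "cmod (radial_seq \<zeta> n) < 1"
  unfolding cmod_radial_seq by simp

lemma radial_seq_tendsto: "radial_seq \<zeta> \<longlonglongrightarrow> \<zeta>"
proof -
  have "(\<lambda>n. 1 - 1 / real (n + 2)) \<longlonglongrightarrow> 1" by real_asymp
  then have "(\<lambda>n. complex_of_real (1 - 1 / real (n + 2)) * \<zeta>) \<longlonglongrightarrow> of_real 1 * \<zeta>"
    by (intro tendsto_intros)
  then show ?thesis by (simp add: radial_seq_def[abs_def])
qed

lemma has_nt_limit_radial_seq:
  assumes "has_nt_limit f \<zeta> L"
  shows "(\<lambda>n. f (radial_seq \<zeta> n)) \<longlonglongrightarrow> L"
proof -
  have dist: "cmod (radial_seq \<zeta> n - \<zeta>) = 1 / real (n + 2)" for n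
  proof -
    have "radial_seq \<zeta> n - \<zeta> = of_real (- (1 / real (n + 2))) * \<zeta>"
      by (simp add: radial_seq_def algebra_simps)
    then show ?thesis using \<zeta> by (simp only: norm_mult norm_of_real) simp
  qed
  have mem: "radial_seq \<zeta> n \<in> stolz_region 2 \<zeta>" for n
    unfolding stolz_region_def mem_Collect_eq dist cmod_radial_seq using radial_seq_mem[of n] by simp
  have "radial_seq \<zeta> n \<noteq> \<zeta>" for n
    using radial_seq_mem[of n] \<zeta> by auto
  with mem have "filterlim (radial_seq \<zeta>) (at \<zeta> within stolz_region 2 \<zeta>) sequentially"
    unfolding filterlim_at using radial_seq_tendsto by auto
  moreover have "(f \<longlongrightarrow> L) (at \<zeta> within stolz_region 2 \<zeta>)"
    using assms by (simp add: has_nt_limit_def)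
  ultimately show ?thesis by (rule filterlim_compose[rotated])
qed

text \<open>
  Around a point \<open>w\<close> of a Stolz region the disc of radius $(1 - |w|)/2$ lies in a wider Stolz
  region, and its radius is comparable to $|w - \<zeta>|$. There the function
  $f(z) - \<eta> - d (z - \<zeta>)$ is small compared with that radius, so Cauchy's estimate makes its
  derivative $f'(w) - d$ small.
\<close>

lemma has_nt_limit_deriv:
  assumes hol: "f holomorphic_on unit_disc"
    and quot: "has_nt_limit (\<lambda>z. (f z - \<eta>) / (z - \<zeta>)) \<zeta> d"
  shows "has_nt_limit (deriv f) \<zeta> d"
  unfolding has_nt_limit_def
proof (intro allI impI)
  fix \<alpha> :: real assume \<alpha>: "\<alpha> > 1"
  \<comment> \<open>Chosen so that $\beta (1 - |w|)/2 = \alpha (1 - |w|) + (1 - |w|)/2$ bounds the distance from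
    \<open>\<zeta>\<close> to the points of the disc around \<open>w\<close>.\<close>
  define \<beta> where "\<beta> = 2 * \<alpha> + 1"
  have \<beta>: "\<beta> > 1" using \<alpha> by (simp add: \<beta>_def)
  show "(deriv f \<longlongrightarrow> d) (at \<zeta> within stolz_region \<alpha> \<zeta>)"
    unfolding Lim_within
  proof (intro allI impI)
    fix e :: real assume e: "e > 0"
    define e' where "e' = e / (2 * \<beta>)"
    have e': "e' > 0" using e \<beta> by (simp add: e'_def)
    obtain \<delta> where \<delta>: "\<delta> > 0"
      "\<And>z. z \<in> stolz_region \<beta> \<zeta> \<Longrightarrow> 0 < dist z \<zeta> \<Longrightarrow> dist z \<zeta> < \<delta> \<Longrightarrow> dist ((f z - \<eta>) / (z - \<zeta>)) d < e'"
      using quot \<beta> e' unfolding has_nt_limit_def Lim_within by blast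
    show "\<exists>\<delta>>0. \<forall>z\<in>stolz_region \<alpha> \<zeta>. 0 < dist z \<zeta> \<and> dist z \<zeta> < \<delta> \<longrightarrow> dist (deriv f z) d < e"
    proof (intro exI[of _ "\<delta> / 2"] conjI ballI impI)
      fix w assume w: "w \<in> stolz_region \<alpha> \<zeta>" and "0 < dist w \<zeta> \<and> dist w \<zeta> < \<delta> / 2"
      then have w_dist: "cmod (w - \<zeta>) < \<delta> / 2" by (simp add: dist_norm)
      have w1: "cmod w < 1" and w_stolz: "cmod (w - \<zeta>) < \<alpha> * (1 - cmod w)"
        using w by (auto simp: stolz_region_def field_simps)
      define r where "r = (1 - cmod w) / 2"
      have r: "r > 0" using w1 by (simp add: r_def)
      have "1 - cmod w \<le> cmod (w - \<zeta>)"
        using norm_triangle_ineq2[of \<zeta> w] \<zeta> by (simp add: norm_minus_commute)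
      then have r_le: "r \<le> cmod (w - \<zeta>) / 2" by (simp add: r_def)
      let ?\<phi> = "\<lambda>z. f z - \<eta> - d * (z - \<zeta>)"
      have ball: "cmod z < 1" "cmod (z - \<zeta>) < \<beta> * r" "cmod (z - \<zeta>) < \<delta>" "z \<in> stolz_region \<beta> \<zeta>" if z: "cmod (w - z) \<le> r" for z
      proof -
        have z1: "r \<le> 1 - cmod z"
          using norm_triangle_ineq2[of z w] z by (simp add: r_def norm_minus_commute)
        then show "cmod z < 1" using r by simp
        have tri: "cmod (z - \<zeta>) \<le> cmod (w - \<zeta>) + r"
          using norm_triangle_ineq[of "w - \<zeta>" "z - w"] z by (simp add: norm_minus_commute)
        then show "cmod (z - \<zeta>) < \<delta>" using r_le w_dist norm_ge_zero[of "w - \<zeta>"] by linarith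
        show "cmod (z - \<zeta>) < \<beta> * r"
        proof -
          have "\<beta> * r = \<alpha> * (1 - cmod w) + r" by (simp add: \<beta>_def r_def field_simps)
          then show ?thesis using tri w_stolz by linarith
        qed
        also have "\<dots> \<le> \<beta> * (1 - cmod z)" using z1 \<beta> by (intro mult_left_mono) auto
        finally show "z \<in> stolz_region \<beta> \<zeta>"
          using \<open>cmod z < 1\<close> by (simp add: stolz_region_def divide_less_eq)
      qed
      have sub: "cball w r \<subseteq> unit_disc" using ball(1) by (auto simp: dist_norm)
      have hol\<phi>: "?\<phi> holomorphic_on unit_disc" by (intro holomorphic_intros hol)
      have bound: "cmod (?\<phi> z) \<le> e' * (\<beta> * r)" if z: "cmod (w - z) = r" for z
      proof -
        have "cmod z < 1" using ball(1) z by simp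
        then have ne: "z \<noteq> \<zeta>" using \<zeta> by auto
        then have "dist ((f z - \<eta>) / (z - \<zeta>)) d < e'"
          using \<delta>(2)[OF ball(4)[of z]] ball(3)[of z] z by (simp add: dist_norm)
        moreover have "?\<phi> z = ((f z - \<eta>) / (z - \<zeta>) - d) * (z - \<zeta>)"
          using ne by (simp add: field_simps)
        ultimately show ?thesis
          using ball(2)[of z] z e' unfolding dist_norm
          by (simp only: norm_mult) (intro mult_mono, auto)
      qed
      have "cmod ((deriv ^^ 1) ?\<phi> w) \<le> fact 1 * (e' * (\<beta> * r)) / r ^ 1"
      proof (rule Cauchy_inequality)
        show "?\<phi> holomorphic_on ball w r"
          using hol\<phi> sub ball_subset_cball holomorphic_on_subset by blast
        show "continuous_on (cball w r) ?\<phi>"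
          using hol\<phi> sub holomorphic_on_imp_continuous_on holomorphic_on_subset by blast
      qed (use r bound in auto)
      moreover have "deriv ?\<phi> w = deriv f w - d"
      proof -
        have "(f has_field_derivative deriv f w) (at w)"
          using hol w1 by (intro holomorphic_derivI[of f unit_disc]) auto
        then show ?thesis by (intro DERIV_imp_deriv) (auto intro!: derivative_eq_intros)
      qed
      ultimately have "cmod (deriv f w - d) \<le> e' * \<beta>" using r by simp
      also have "\<dots> < e" using e \<beta> by (simp add: e'_def)
      finally show "dist (deriv f w) d < e" by (simp add: dist_norm)
    qed (use \<delta> in simp)
  qed
qed

end

section \<open>Boundary kernels and the angular derivative\<close>

text \<open>
  Bounded kernels along the radius have a weak limit, which is the kernel at the boundary point. The
  hypothesis on limits is used twice: for a kernel at an interior point where \<open>I\<close> does not vanish,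
  to obtain the limit of \<open>I\<close>, and for the boundary kernel, which is a difference quotient of \<open>I\<close>.
\<close>

lemma ADC_if_bounded_kernels:
  assumes I: "inner_function I" and \<zeta>: "\<zeta> \<in> unit_circle"
    and limits: "\<And>x. x \<in> model_series I \<Longrightarrow> \<exists>c. has_nt_limit (val x) \<zeta> c"
    and bounded: "\<forall>\<^sub>F n in sequentially. norm (model_kernel I (radial_seq \<zeta> n)) \<le> C"
  shows "\<zeta> \<in> ADC I"
proof -
  define l where "l = radial_seq \<zeta>"
  have l1: "cmod (l n) < 1" for n using radial_seq_mem[OF \<zeta>] by (simp add: l_def)
  have l_lim: "l \<longlonglongrightarrow> \<zeta>" using radial_seq_tendsto[OF \<zeta>] by (simp add: l_def)
  have kernel_bound: "\<forall>\<^sub>F n in sequentially. norm (model_kernel I (l n)) \<le> C"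
    using bounded by (simp add: l_def)
  have nonzero: "1 - cnj \<mu> * z \<noteq> 0" if "cmod \<mu> \<le> 1" "cmod z < 1" for \<mu> z
  proof
    assume "1 - cnj \<mu> * z = 0"
    then have "cmod (cnj \<mu> * z) = 1" by (metis eq_iff_diff_eq_0 norm_one)
    moreover have "cmod (cnj \<mu> * z) \<le> cmod z"
      using that by (simp add: norm_mult mult_left_le_one_le)
    ultimately show False using that by simp
  qed
  obtain \<eta> where \<eta>: "has_nt_limit I \<zeta> \<eta>"
  proof -
    obtain \<mu> where \<mu>: "cmod \<mu> < 1" "I \<mu> \<noteq> 0" using inner_function_nonzero[OF I] by blast
    obtain c where c: "has_nt_limit (val (model_kernel I \<mu>)) \<zeta> c"
      using limits[OF model_kernel_mem[OF I \<mu>(1)]] by blast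
    have "has_nt_limit (\<lambda>z. (1 - val (model_kernel I \<mu>) z * (1 - cnj \<mu> * z)) / cnj (I \<mu>)) \<zeta>
        ((1 - c * (1 - cnj \<mu> * \<zeta>)) / cnj (I \<mu>))"
      using c \<mu>(2) unfolding has_nt_limit_def by (auto intro!: tendsto_intros)
    moreover have "I z = (1 - val (model_kernel I \<mu>) z * (1 - cnj \<mu> * z)) / cnj (I \<mu>)"
      if "z \<in> unit_disc" for z
      using that \<mu> nonzero[of \<mu> z] by (simp add: val_model_kernel[OF I])
    ultimately have "has_nt_limit I \<zeta> ((1 - c * (1 - cnj \<mu> * \<zeta>)) / cnj (I \<mu>))"
      by (rule has_nt_limit_transform)
    then show thesis by (rule that)
  qed
  have I_lim: "(\<lambda>n. I (l n)) \<longlonglongrightarrow> \<eta>"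
    using has_nt_limit_radial_seq[OF \<zeta> \<eta>] by (simp add: l_def)
  have norm_eta: "cmod \<eta> = 1"
  proof -
    have "(\<lambda>n. 1 - (cmod (I (l n)))\<^sup>2) \<longlonglongrightarrow> 0"
    proof (rule Lim_null_comparison)
      show "\<forall>\<^sub>F n in sequentially. norm (1 - (cmod (I (l n)))\<^sup>2) \<le> C\<^sup>2 * (1 - (cmod (l n))\<^sup>2)"
        using kernel_bound
      proof eventually_elim
        case (elim n)
        have pos: "0 < 1 - (cmod (l n))\<^sup>2" using l1[of n] by (simp add: abs_square_less_1)
        have "0 \<le> 1 - (cmod (I (l n)))\<^sup>2"
          using cmod_inner_function_le[OF I l1] by (simp add: abs_square_le_1)
        moreover have "(1 - (cmod (I (l n)))\<^sup>2) / (1 - (cmod (l n))\<^sup>2) \<le> C\<^sup>2"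
          unfolding norm_model_kernel_square[OF I l1, symmetric] using elim by (intro power_mono) auto
        ultimately show ?case using pos by (simp add: pos_divide_le_eq)
      qed
      have "(\<lambda>n. C\<^sup>2 * (1 - (cmod (l n))\<^sup>2)) \<longlonglongrightarrow> C\<^sup>2 * (1 - (cmod \<zeta>)\<^sup>2)"
        by (intro tendsto_intros l_lim)
      then show "(\<lambda>n. C\<^sup>2 * (1 - (cmod (l n))\<^sup>2)) \<longlonglongrightarrow> 0" using \<zeta> by simp
    qed
    moreover have "(\<lambda>n. 1 - (cmod (I (l n)))\<^sup>2) \<longlonglongrightarrow> 1 - (cmod \<eta>)\<^sup>2"
      by (intro tendsto_intros I_lim)
    ultimately have "0 = 1 - (cmod \<eta>)\<^sup>2" by (rule LIMSEQ_unique)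
    then have "(cmod \<eta>)\<^sup>2 = 1\<^sup>2" by simp
    then show ?thesis by (rule power2_eq_imp_eq) auto
  qed
  \<comment> \<open>The boundary kernel. Pairing the weak limit with $I h$ shows that it is in the model space, and
    pairing it with Szego kernels computes its values.\<close>
  obtain q where q: "q \<in> model_series I"
    and val_q: "\<And>z. cmod z < 1 \<Longrightarrow> val q z = (1 - cnj \<eta> * I z) / (1 - cnj \<zeta> * z)"
  proof -
    define y where "y m = cnj \<zeta> ^ m
        - cnj \<eta> * (\<Sum>i=0..m. fps_nth (fps_expansion I 0) i * cnj \<zeta> ^ (m - i))" for m
    have coeff: "(\<lambda>n. hcoeff (model_kernel I (l n)) m) \<longlonglongrightarrow> y m" for m
      unfolding hcoeff_model_kernel[OF I l1] y_def by (intro tendsto_intros l_lim I_lim)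
    obtain q where q: "\<And>m. hcoeff q m = y m"
      using hardy_of_coeff_limit[OF kernel_bound coeff] by blast
    have weak: "(\<lambda>n. cinner (model_kernel I (l n)) h) \<longlonglongrightarrow> cinner q h" for h
      using coeff by (intro cinner_tendsto_of_coeff_tendsto[OF kernel_bound]) (simp add: q)
    have "cinner (model_kernel I (l n)) (imul I h) = 0" for n h
      using model_kernel_mem[OF I l1] by (simp add: model_series_def)
    then have "cinner q (imul I h) = 0" for h
      using weak[of "imul I h"] by (simp add: LIMSEQ_const_iff)
    then have "q \<in> model_series I" by (simp add: model_series_def)
    moreover have "val q z = (1 - cnj \<eta> * I z) / (1 - cnj \<zeta> * z)" if z: "cmod z < 1" for z
    proof -
      have "(\<lambda>n. (1 - cnj (I (l n)) * I z) / (1 - cnj (l n) * z)) \<longlonglongrightarrow> val q z"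
        using weak[of "szego z"] by (simp only: cinner_szego[OF z] val_model_kernel[OF I l1 z])
      moreover have "(\<lambda>n. (1 - cnj (I (l n)) * I z) / (1 - cnj (l n) * z))
          \<longlonglongrightarrow> (1 - cnj \<eta> * I z) / (1 - cnj \<zeta> * z)"
        using \<zeta> by (intro tendsto_intros l_lim I_lim nonzero z) simp
      ultimately show ?thesis by (rule LIMSEQ_unique)
    qed
    ultimately show thesis by (rule that)
  qed
  obtain d where d: "has_nt_limit (val q) \<zeta> d" using limits[OF q] by blast
  have "has_nt_limit (\<lambda>z. \<eta> * cnj \<zeta> * val q z) \<zeta> (\<eta> * cnj \<zeta> * d)"
    using d unfolding has_nt_limit_def by (auto intro!: tendsto_intros)
  moreover have "(I z - \<eta>) / (z - \<zeta>) = \<eta> * cnj \<zeta> * val q z" if z: "z \<in> unit_disc" for z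
  proof -
    have z1: "cmod z < 1" using z by simp
    have unimodular: "\<eta> * cnj \<eta> = 1" "\<zeta> * cnj \<zeta> = 1"
      using norm_eta \<zeta> by (simp_all add: complex_norm_square[symmetric])
    have "1 - cnj \<eta> * I z = cnj \<eta> * (\<eta> - I z)" "1 - cnj \<zeta> * z = cnj \<zeta> * (\<zeta> - z)"
      using unimodular by (simp_all add: algebra_simps)
    then have "\<eta> * cnj \<zeta> * val q z = (\<eta> * cnj \<eta>) * cnj \<zeta> * (\<eta> - I z) / (cnj \<zeta> * (\<zeta> - z))"
      by (simp add: val_q[OF z1])
    also have "\<dots> = (\<eta> - I z) / (\<zeta> - z)"
      unfolding unimodular(1) mult_1 by (rule mult_divide_mult_cancel_left) (use unimodular in auto)
    also have "\<dots> = (I z - \<eta>) / (z - \<zeta>)"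
      by (metis minus_diff_eq minus_divide_divide)
    finally show ?thesis by simp
  qed
  ultimately have "has_nt_limit (\<lambda>z. (I z - \<eta>) / (z - \<zeta>)) \<zeta> (\<eta> * cnj \<zeta> * d)"
    by (rule has_nt_limit_transform)
  then have "has_nt_limit (deriv I) \<zeta> (\<eta> * cnj \<zeta> * d)"
    by (rule has_nt_limit_deriv[OF \<zeta> inner_function_holomorphic[OF I]])
  then show ?thesis using \<zeta> norm_eta \<eta> by (auto simp: ADC_def)
qed

section \<open>Limits of the functions in a nearly invariant subspace\<close>

context
  fixes g I :: "complex \<Rightarrow> complex" and \<zeta> :: complex
  assumes I: "inner_function I" and \<zeta>: "\<zeta> \<in> unit_circle"
    and limits: "\<And>x. x \<in> model_series I \<Longrightarrow> \<exists>c. has_nt_limit (\<lambda>z. g z * val x z) \<zeta> c"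
begin

text \<open>
  The vector that represents $h \mapsto g(\mu) h(\mu)$ on the model space.
\<close>

definition weighted_kernel :: "complex \<Rightarrow> hardy" where
  "weighted_kernel \<mu> = scaleC (cnj (g \<mu>)) (model_kernel I \<mu>)"

lemma cinner_weighted_kernel_tendsto:
  assumes x: "x \<in> model_series I" and c: "has_nt_limit (\<lambda>z. g z * val x z) \<zeta> c"
  shows "(\<lambda>n. cinner x (weighted_kernel (radial_seq \<zeta> n))) \<longlonglongrightarrow> c"
proof -
  have "cinner x (weighted_kernel (radial_seq \<zeta> n))
      = g (radial_seq \<zeta> n) * val x (radial_seq \<zeta> n)" for n
    using cinner_model_kernel[OF I radial_seq_mem[OF \<zeta>] x]
    by (simp add: weighted_kernel_def cinner_scaleC_right)
  then show ?thesis using has_nt_limit_radial_seq[OF \<zeta> c] by simp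
qed

lemma weighted_kernels_bounded:
  obtains B where "\<And>n. norm (weighted_kernel (radial_seq \<zeta> n)) \<le> B"
proof -
  have "bounded (range (\<lambda>n. weighted_kernel (radial_seq \<zeta> n)))"
  proof (rule weakly_bounded_imp_bounded[OF closed_model_series[OF I] subspace_model_series[OF I]])
    show "weighted_kernel (radial_seq \<zeta> n) \<in> model_series I" for n
      unfolding weighted_kernel_def
      by (intro scaleC_mem_model_series I model_kernel_mem radial_seq_mem \<zeta>)
    show "bounded (range (\<lambda>n. inner x (weighted_kernel (radial_seq \<zeta> n))))"
      if x: "x \<in> model_series I" for x
    proof -
      obtain c where "has_nt_limit (\<lambda>z. g z * val x z) \<zeta> c" using limits[OF x] by blast
      then have "bounded (range (\<lambda>n. cinner x (weighted_kernel (radial_seq \<zeta> n))))"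
        by (intro convergent_imp_bounded cinner_weighted_kernel_tendsto x)
      then obtain b where "\<And>n. cmod (cinner x (weighted_kernel (radial_seq \<zeta> n))) \<le> b"
        by (auto simp: bounded_iff)
      then have "\<bar>inner x (weighted_kernel (radial_seq \<zeta> n))\<bar> \<le> b" for n
        unfolding inner_hardy_def using abs_Re_le_cmod order_trans by blast
      then show ?thesis by (auto simp: bounded_iff)
    qed
  qed
  then show thesis using that by (auto simp: bounded_iff)
qed

text \<open>
  The weighted kernels are bounded and tend to zero coefficientwise, hence weakly.
\<close>

lemma nt_limit_zero_if_weight_tendsto_zero:
  assumes g: "has_nt_limit g \<zeta> 0" and x: "x \<in> model_series I"
  shows "has_nt_limit (\<lambda>z. g z * val x z) \<zeta> 0"
proof -
  let ?w = "\<lambda>n. weighted_kernel (radial_seq \<zeta> n)"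
  obtain B where B: "\<And>n. norm (?w n) \<le> B" using weighted_kernels_bounded by blast
  have w_coeff: "(\<lambda>n. hcoeff (?w n) m) \<longlonglongrightarrow> hcoeff 0 m" for m
  proof -
    define C where "C = 1 + (\<Sum>i=0..m. cmod (fps_nth (fps_expansion I 0) i))"
    have "cmod (hcoeff (?w n) m) \<le> cmod (g (radial_seq \<zeta> n)) * C" for n
      using cmod_hcoeff_model_kernel_le[OF I radial_seq_mem[OF \<zeta>], of n m]
      by (simp add: weighted_kernel_def C_def norm_mult mult_left_mono)
    moreover have "(\<lambda>n. cmod (g (radial_seq \<zeta> n)) * C) \<longlonglongrightarrow> 0"
      using has_nt_limit_radial_seq[OF \<zeta> g] by (auto intro!: tendsto_eq_intros)
    ultimately have "(\<lambda>n. hcoeff (?w n) m) \<longlonglongrightarrow> 0"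
      by (rule Lim_null_comparison[OF always_eventually[OF allI]])
    then show ?thesis by simp
  qed
  obtain c where c: "has_nt_limit (\<lambda>z. g z * val x z) \<zeta> c" using limits[OF x] by blast
  have "(\<lambda>n. cinner x (?w n)) \<longlonglongrightarrow> c" by (rule cinner_weighted_kernel_tendsto[OF x c])
  moreover have "(\<lambda>n. cinner x (?w n)) \<longlonglongrightarrow> cnj (cinner 0 x)"
    unfolding cinner_commute[of x "weighted_kernel _"]
    using B w_coeff by (intro tendsto_cnj cinner_tendsto_of_coeff_tendsto[where C = B]) auto
  ultimately have "c = cnj (cinner 0 x)" by (rule LIMSEQ_unique)
  then show ?thesis using c by (simp add: cinner_def)
qed

text \<open>
  Away from zero the weight can be divided out, both from the functions and from the kernels.
\<close>

lemma ADC_if_weight_tendsto_nonzero: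
  assumes g: "has_nt_limit g \<zeta> L" and L: "L \<noteq> 0"
  shows "\<zeta> \<in> ADC I"
proof -
  obtain B where B: "\<And>n. norm (weighted_kernel (radial_seq \<zeta> n)) \<le> B"
    using weighted_kernels_bounded by blast
  show ?thesis
  proof (rule ADC_if_bounded_kernels[OF I \<zeta>])
    show "\<exists>c. has_nt_limit (val x) \<zeta> c" if x: "x \<in> model_series I" for x
    proof -
      obtain c where "has_nt_limit (\<lambda>z. g z * val x z) \<zeta> c" using limits[OF x] by blast
      then have quot: "has_nt_limit (\<lambda>z. g z * val x z / g z) \<zeta> (c / L)"
        by (rule has_nt_limit_divide[OF _ g L])
      have "(val x \<longlongrightarrow> c / L) (at \<zeta> within stolz_region \<alpha> \<zeta>)" if \<alpha>: "\<alpha> > 1" for \<alpha>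
      proof (rule Lim_transform_eventually)
        show "((\<lambda>z. g z * val x z / g z) \<longlongrightarrow> c / L) (at \<zeta> within stolz_region \<alpha> \<zeta>)"
          using quot \<alpha> by (simp add: has_nt_limit_def)
        have "\<forall>\<^sub>F z in at \<zeta> within stolz_region \<alpha> \<zeta>. g z \<noteq> 0"
          using g \<alpha> by (intro tendsto_imp_eventually_ne[OF _ L]) (simp add: has_nt_limit_def)
        then show "\<forall>\<^sub>F z in at \<zeta> within stolz_region \<alpha> \<zeta>. g z * val x z / g z = val x z"
          by eventually_elim simp
      qed
      then show ?thesis by (auto simp: has_nt_limit_def)
    qed
    have pos: "0 < cmod L / 2" using L by simp
    have "\<forall>\<^sub>F n in sequentially. cmod L / 2 < cmod (g (radial_seq \<zeta> n))"
      using tendsto_norm[OF has_nt_limit_radial_seq[OF \<zeta> g]] by (rule order_tendstoD) (use L in simp)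
    then show "\<forall>\<^sub>F n in sequentially. norm (model_kernel I (radial_seq \<zeta> n)) \<le> B / (cmod L / 2)"
    proof eventually_elim
      case (elim n)
      have "norm (model_kernel I (radial_seq \<zeta> n)) * (cmod L / 2)
          \<le> norm (model_kernel I (radial_seq \<zeta> n)) * cmod (g (radial_seq \<zeta> n))"
        using elim by (intro mult_left_mono) auto
      also have "\<dots> \<le> B" using B[of n] by (simp add: weighted_kernel_def norm_scaleC mult.commute)
      finally show ?case using pos by (simp only: pos_le_divide_eq)
    qed
  qed
qed

end

theorem theorem5p2:
  fixes M :: "(complex \<Rightarrow> complex) set" and g I :: "complex \<Rightarrow> complex" and \<zeta> :: complex
  assumes "nearly_invariant_with M g I"
    and "M \<noteq> {\<lambda>z. 0}"
    and "\<zeta> \<in> unit_circle"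
    and "\<forall>f\<in>M. \<exists>L. has_nt_limit f \<zeta> L"
  shows "\<zeta> \<in> ADC I \<or> \<zeta> \<in> nt_zero_set M"
proof -
  have I: "inner_function I" and I0: "I 0 = 0" and M: "M = (\<lambda>h z. g z * h z) ` model_space I"
    using assms(1) by (auto simp: nearly_invariant_with_def)
  have "model_space I = val ` model_series I"
    using val_mem_model_space_iff[OF I] by (auto simp: model_space_def H2_eq_range_val)
  then have M_eq: "M = (\<lambda>x z. g z * val x z) ` model_series I"
    by (auto simp: M image_image)
  have limits: "\<exists>c. has_nt_limit (\<lambda>z. g z * val x z) \<zeta> c" if "x \<in> model_series I" for x
    using assms(4) that by (auto simp: M_eq)
  \<comment> \<open>As $I(0) = 0$, the kernel at 0 is the constant 1.\<close>
  obtain L where "has_nt_limit (\<lambda>z. g z * val (model_kernel I 0) z) \<zeta> L"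
    using limits[OF model_kernel_mem[OF I, of 0]] by auto
  then have L: "has_nt_limit g \<zeta> L"
    by (rule has_nt_limit_transform) (simp add: val_model_kernel[OF I] I0)
  show ?thesis
  proof (cases "L = 0")
    case True
    have "has_nt_limit (\<lambda>z. g z * val x z) \<zeta> 0" if "x \<in> model_series I" for x
      using nt_limit_zero_if_weight_tendsto_zero[OF I assms(3) limits] L True that by blast
    then show ?thesis using assms(3) by (auto simp: nt_zero_set_def M_eq)
  next
    case False
    then show ?thesis
      using ADC_if_weight_tendsto_nonzero[OF I assms(3) limits L] by blast
  qed
qed

end
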